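(* Let $k$ be a field and $n\geq2$ an even integer. Let $f(x,y)=f_0x^n+\cdots+f_ny^n$ be a separable binary form of degree $n$ over $k$ with $f_0\neq0$. Then the set of ${\rm SL}_n^\pm(k)$-orbits of elements $v\in V(k)$ with $f_v=f$ is in bijection with the set $(K_f^\times/K_f^{\times2})_{N\equiv f_0}$, and the stabilizer in ${\rm SL}_n^\pm(k)$ of any $v\in V(k)$ with $f_v=f$ is isomorphic to $K_f^\times[2]=\{\kappa\in K_f^\times:\kappa^2=1\}$.
   Context: $V(k)$ is the space of pairs $(A,B)$ of symmetric $n\times n$ matrices over $k$, and ${\rm SL}_n^\pm(k)=\{g\in{\rm GL}_n(k):\det g=\pm1\}$ acts by $g\cdot(A,B)=(gAg^t,gBg^t)$. The invariant binary form of $v=(A,B)$ is $f_v(x,y)=(-1)^{n/2}\det(Ax-By)$. A binary form is separable if it factors into distinct linear factors over $\bar k$. $K_f=k[x]/(f(x,1))$, an $n$-dimensional $k$-algebra, and $(K_f^\times/K_f^{\times2})_{N\equiv f_0}$ denotes the set of classes $\alpha\in K_f^\times/K_f^{\times2}$ whose norm $N_{K_f/k}(\alpha)$ lies in the class of $f_0$ in $k^\times/k^{\times2}$. *)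

theory Defs
  imports
    "Jordan_Normal_Form.Determinant"
    "HOL-Algebra.Group_Action"
    "HOL-Algebra.QuotRing"
    "HOL-Algebra.Algebraic_Closure_Type"
begin

subsection \<open>Pairs of symmetric matrices\<close>

definition sym_pairs :: "nat \<Rightarrow> ('a::field mat \<times> 'a mat) set" where
  "sym_pairs n = {(A, B). A \<in> carrier_mat n n \<and> B \<in> carrier_mat n n \<and>
                          A\<^sup>T = A \<and> B\<^sup>T = B}"

definition SLpm :: "nat \<Rightarrow> 'a::field mat monoid" where
  "SLpm n = \<lparr>carrier = {g \<in> carrier_mat n n. det g = 1 \<or> det g = -1},
             monoid.mult = (*), one = 1\<^sub>m n\<rparr>"

definition pair_act :: "'a::field mat \<Rightarrow> 'a mat \<times> 'a mat \<Rightarrow> 'a mat \<times> 'a mat" where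
  "pair_act g v = (g * fst v * g\<^sup>T, g * snd v * g\<^sup>T)"

definition stabilizer_group :: "nat \<Rightarrow> 'a::field mat \<times> 'a mat \<Rightarrow> 'a mat monoid" where
  "stabilizer_group n v = (SLpm n)\<lparr>carrier := stabilizer (SLpm n) pair_act v\<rparr>"


subsection \<open>Binary forms\<close>

text \<open>Polynomials in \<open>x, y\<close> over \<open>k\<close> are elements of \<open>k[y][x]\<close>: the outer variable is \<open>x\<close>,
  the inner one is \<open>y\<close>. Equality of forms is equality of polynomials, which matters when
  \<open>k\<close> is finite.\<close>

definition linear_form :: "'a::field \<Rightarrow> 'a \<Rightarrow> 'a poly poly" where \<comment> \<open>\<open>a x + b y\<close>\<close>
  "linear_form a b = [:[:0, b:], [:a:]:]"

definition binary_form :: "nat \<Rightarrow> (nat \<Rightarrow> 'a::field) \<Rightarrow> 'a poly poly" where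
  "binary_form n f = (\<Sum>i\<le>n. Polynomial.monom (Polynomial.monom (f i) i) (n - i))"

definition dehomogenize :: "'a::field poly poly \<Rightarrow> 'a poly" where \<comment> \<open>\<open>f(x, 1)\<close>\<close>
  "dehomogenize F = map_poly (\<lambda>c. poly c 1) F"

text \<open>Linear factors are only determined up to scalars, so distinct means pairwise
  non-proportional.\<close>

definition separable_form :: "nat \<Rightarrow> 'a::field poly poly \<Rightarrow> bool" where
  "separable_form n F \<longleftrightarrow>
     (\<exists>a b :: nat \<Rightarrow> 'a alg_closure.
        map_poly (map_poly to_ac) F = (\<Prod>i<n. linear_form (a i) (b i)) \<and>
        (\<forall>i<n. \<forall>j<n. i \<noteq> j \<longrightarrow> a i * b j \<noteq> a j * b i))"

definition invariant_form :: "nat \<Rightarrow> 'a::field mat \<times> 'a mat \<Rightarrow> 'a poly poly" where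
  "invariant_form n v =
     (-1) ^ (n div 2) * det (mat n n (\<lambda>(i, j). linear_form (fst v $$ (i, j)) (- (snd v $$ (i, j)))))"


subsection \<open>The algebra \<open>k[x]/(p)\<close> and its norm\<close>

definition quot_ideal :: "'a::field poly \<Rightarrow> 'a poly set" where
  "quot_ideal p = PIdl\<^bsub>ring_of_type_algebra\<^esub> p"

definition quot_alg :: "'a::field poly \<Rightarrow> 'a poly set ring" where
  "quot_alg p = ring_of_type_algebra Quot quot_ideal p"

definition quot_class :: "'a::field poly \<Rightarrow> 'a poly \<Rightarrow> 'a poly set" where
  "quot_class p a = quot_ideal p +>\<^bsub>ring_of_type_algebra\<^esub> a"

text \<open>The coordinate of a residue class on \<open>x\<^sup>i\<close>, in the basis
  \<open>1, x, \<dots>, x\<^bsup>deg p - 1\<^esup>\<close> of \<open>k[x]/(p)\<close>; any representative gives the same value.\<close>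

definition quot_coord :: "'a::field poly \<Rightarrow> 'a poly set \<Rightarrow> nat \<Rightarrow> 'a" where
  "quot_coord p C i = Polynomial.coeff ((SOME a. a \<in> C) mod p) i"

text \<open>The norm is the determinant of multiplication by \<open>C\<close>; column \<open>j\<close> of the matrix holds
  the coordinates of \<open>C\<close> times \<open>x\<^sup>j\<close>.\<close>

definition quot_norm :: "'a::field poly \<Rightarrow> 'a poly set \<Rightarrow> 'a" where
  "quot_norm p C =
     det (mat (Polynomial.degree p) (Polynomial.degree p)
       (\<lambda>(i, j). quot_coord p (C \<otimes>\<^bsub>quot_alg p\<^esub> quot_class p (Polynomial.monom 1 j)) i))"


subsection \<open>Units modulo squares\<close>

definition unit_squares :: "('r, 'm) ring_scheme \<Rightarrow> 'r set" where
  "unit_squares R = {u [^]\<^bsub>R\<^esub> (2::nat) | u. u \<in> Units R}"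

definition units_mod_squares :: "('r, 'm) ring_scheme \<Rightarrow> 'r set monoid" where
  "units_mod_squares R = units_of R Mod unit_squares R"

definition square_class :: "('r, 'm) ring_scheme \<Rightarrow> 'r \<Rightarrow> 'r set" where
  "square_class R u = unit_squares R #>\<^bsub>units_of R\<^esub> u"

definition two_torsion_units :: "('r, 'm) ring_scheme \<Rightarrow> 'r monoid" where
  "two_torsion_units R =
     (units_of R)\<lparr>carrier := {u \<in> Units R. u [^]\<^bsub>R\<^esub> (2::nat) = \<one>\<^bsub>R\<^esub>}\<rparr>"

text \<open>A class \<open>\<alpha>\<close> is a coset of units; its norm in \<open>k\<^sup>\<times>/k\<^sup>\<times>\<^sup>2\<close> is the class of \<open>c\<close> if and only if all
  norms of its elements lie in that class.\<close>

definition norm_classes :: "'a::field poly \<Rightarrow> 'a \<Rightarrow> 'a poly set set set" where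
  "norm_classes p c =
     {\<alpha> \<in> carrier (units_mod_squares (quot_alg p)).
        quot_norm p ` \<alpha> \<subseteq> square_class ring_of_type_algebra c}"


subsection \<open>Sanity checks\<close>

lemma group_SLpm: "group (SLpm n :: 'a::field mat monoid)"
proof (rule groupI)
  fix g :: "'a mat" assume g: "g \<in> carrier (SLpm n)"
  hence gc: "g \<in> carrier_mat n n" and d: "det g = 1 \<or> det g = -1" by (auto simp: SLpm_def)
  from d have "det g \<noteq> 0" by auto
  then obtain h where h: "h \<in> carrier_mat n n" "h * g = 1\<^sub>m n"
    using det_non_zero_imp_unit[OF gc] by (auto simp: Units_def ring_mat_def)
  have "det h * det g = 1" using det_mult[OF h(1) gc] h(2) by simp
  with d have "det h = 1 \<or> det h = -1" by (auto simp: minus_equation_iff)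
  with h show "\<exists>h\<in>carrier (SLpm n). h \<otimes>\<^bsub>SLpm n\<^esub> g = \<one>\<^bsub>SLpm n\<^esub>"
    by (auto simp: SLpm_def)
qed (auto simp: SLpm_def det_mult assoc_mult_mat)

lemma dehomogenize_binary_form:
  "dehomogenize (binary_form n f) = (\<Sum>i\<le>n. Polynomial.monom (f i) (n - i))"
  by (rule poly_eqI)
    (simp add: dehomogenize_def binary_form_def coeff_map_poly coeff_sum poly_sum
      poly_monom if_distrib[of "\<lambda>q. poly q _"] cong: if_cong)

lemma rta_simps:
  "carrier ring_of_type_algebra = (UNIV :: 'b::comm_ring_1 set)"
  "x \<otimes>\<^bsub>ring_of_type_algebra\<^esub> y = x * (y::'b)"
  "\<one>\<^bsub>ring_of_type_algebra\<^esub> = (1::'b)"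
  "\<zero>\<^bsub>ring_of_type_algebra\<^esub> = (0::'b)"
  "x \<oplus>\<^bsub>ring_of_type_algebra\<^esub> y = x + (y::'b)"
  by (simp_all add: ring_of_type_algebra_def)

lemma quot_ideal_eq: "quot_ideal p = {q. p dvd q}"
  by (auto simp: quot_ideal_def cgenideal_def rta_simps dvd_def mult.commute)

lemma ideal_quot_ideal: "ideal (quot_ideal p) ring_of_type_algebra"
  unfolding quot_ideal_def
  by (rule cring.cgenideal_ideal[OF cring_from_type_algebra]) (simp add: rta_simps)

lemma cring_quot_alg: "cring (quot_alg (p :: 'a::field poly))"
  unfolding quot_alg_def
  by (rule ideal.quotient_is_cring[OF ideal_quot_ideal cring_from_type_algebra])

lemma quot_class_eq: "quot_class p a = {b. p dvd b - a}"
proof -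
  have "p dvd b - a \<longleftrightarrow> (\<exists>q. p dvd q \<and> b = q + a)" for b
    by (metis add_diff_cancel_right' diff_add_cancel)
  thus ?thesis
    by (auto simp: quot_class_def quot_ideal_eq a_r_coset_def r_coset_def rta_simps)
qed

lemma carrier_quot_alg: "carrier (quot_alg p) = range (quot_class p)"
  by (auto simp: quot_alg_def FactRing_def A_RCOSETS_def RCOSETS_def quot_class_def
      a_r_coset_def rta_simps)

lemma mult_quot_class:
  "quot_class p a \<otimes>\<^bsub>quot_alg p\<^esub> quot_class p b = quot_class p (a * b)"
  unfolding quot_alg_def quot_class_def
  by (simp add: FactRing_def ideal.rcoset_mult_add[OF ideal_quot_ideal] rta_simps)

lemma quot_coord_quot_class:
  "quot_coord p (quot_class p a) i = Polynomial.coeff (a mod p) i"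
proof -
  have "(SOME b. b \<in> quot_class p a) \<in> quot_class p a"
    by (rule someI[of _ a]) (simp add: quot_class_eq)
  hence "(SOME b. b \<in> quot_class p a) mod p = a mod p"
    by (simp add: quot_class_eq mod_eq_dvd_iff)
  thus ?thesis by (simp add: quot_coord_def)
qed

lemma quot_norm_quot_class:
  "quot_norm p (quot_class p a) =
     det (mat (Polynomial.degree p) (Polynomial.degree p)
       (\<lambda>(i, j). Polynomial.coeff (a * Polynomial.monom 1 j mod p) i))"
  unfolding quot_norm_def mult_quot_class quot_coord_quot_class ..

lemma square_class_field:
  assumes "(c::'a::field) \<noteq> 0"
  shows "square_class ring_of_type_algebra c = {c * d\<^sup>2 | d. d \<noteq> 0}"
proof -
  interpret R: cring "ring_of_type_algebra :: 'a ring" by (rule cring_from_type_algebra)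
  have U: "Units (ring_of_type_algebra :: 'a ring) = {u. u \<noteq> 0}"
    by (auto simp: Units_def rta_simps intro!: exI left_inverse right_inverse)
  show ?thesis
    by (auto simp: square_class_def unit_squares_def U r_coset_def units_of_mult rta_simps
        numeral_2_eq_2 mult_ac)
qed

end

theory Submission
  imports Defs "Jordan_Normal_Form.Char_Poly"
begin

text \<open>Let \<open>p = f(x, 1)\<close>. For \<open>(A, B)\<close> with invariant form \<open>f\<close>, the matrix \<open>T = A\<^sup>-\<^sup>1 B\<close> has
  characteristic polynomial \<open>p / f\<^sub>0\<close>. As \<open>p\<close> is squarefree, \<open>T\<close> has a cyclic vector, so in a
  suitable basis \<open>T\<close> is multiplication by \<open>x\<close> on \<open>K = k[x]/(p)\<close>. Both \<open>A\<close> and \<open>B = A T\<close> being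
  symmetric says that \<open>T\<close> is self-adjoint for the form \<open>A\<close>, and the self-adjoint forms on \<open>K\<close> are
  \<open>(u, v) \<mapsto> \<phi>(a u v)\<close>, where \<open>\<phi>\<close> is the coefficient of \<open>x\<^sup>n\<^sup>-\<^sup>1\<close> and \<open>a \<in> K\<^sup>\<times>\<close>. The isometries between two
  such pairs commute with \<open>x\<close>, hence are multiplications by units \<open>c\<close>, and these replace \<open>a\<close>
  by \<open>a c\<^sup>2\<close>. So \<open>a\<close> modulo squares classifies the pairs up to \<open>GL\<^sub>n\<close>, and the stabilizer is
  \<open>c\<^sup>2 = 1\<close>. The Gram matrix of \<open>\<phi>(u v)\<close> has determinant \<open>(-1)\<^bsup>n/2\<^esup>\<close>, which turns
  \<open>det A = (-1)\<^bsup>n/2\<^esup> f\<^sub>0\<close> into the norm condition on \<open>a\<close> and forces the isometries to have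
  determinant \<open>\<plusminus>1\<close>.\<close>

subsection \<open>Multiplication and Hankel matrices modulo a polynomial\<close>

text \<open>Matrix of multiplication by \<open>a\<close> on k[x]/(p) in the basis 1, x, x^2, ...;
  its determinant is the one that defines \<open>quot_norm\<close>.\<close>

definition mult_mat :: "'a::field poly \<Rightarrow> 'a poly \<Rightarrow> 'a mat" where
  "mult_mat p a = mat (Polynomial.degree p) (Polynomial.degree p)
     (\<lambda>(i, j). Polynomial.coeff (a * Polynomial.monom 1 j mod p) i)"

text \<open>Gram matrix of the form (u, v) -> \<phi>(a u v), where \<phi> reads off the top
  coefficient of the reduced residue.\<close>

definition hankel :: "'a::field poly \<Rightarrow> 'a poly \<Rightarrow> 'a mat" where
  "hankel p a = mat (Polynomial.degree p) (Polynomial.degree p)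
     (\<lambda>(i, j). Polynomial.coeff (a * Polynomial.monom 1 (i + j) mod p) (Polynomial.degree p - 1))"

definition coords :: "nat \<Rightarrow> 'a::zero poly \<Rightarrow> 'a vec" where
  "coords n q = vec n (Polynomial.coeff q)"

lemma quot_norm_eq_det: "quot_norm p (quot_class p a) = det (mult_mat p a)"
  by (simp add: quot_norm_quot_class mult_mat_def)

lemma mult_mat_carrier [simp]:
  "mult_mat p a \<in> carrier_mat (Polynomial.degree p) (Polynomial.degree p)"
  by (simp add: mult_mat_def)

lemma hankel_carrier [simp]:
  "hankel p a \<in> carrier_mat (Polynomial.degree p) (Polynomial.degree p)"
  by (simp add: hankel_def)

lemma coords_surj:
  assumes "w \<in> carrier_vec n" "n > 0"
  obtains q where "Polynomial.degree q < n" "coords n q = (w :: 'a::zero vec)"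
proof
  let ?q = "Poly (map (\<lambda>i. w $ i) [0..<n])"
  show "Polynomial.degree ?q < n"
    by (rule degree_lessI) (use assms in \<open>auto simp: nth_default_def\<close>)
  show "coords n ?q = w"
    by (rule eq_vecI) (use assms in \<open>auto simp: coords_def nth_default_def\<close>)
qed

lemma sum_monom_coeff:
  assumes "Polynomial.degree q < n"
  shows "q = (\<Sum>j<n. Polynomial.monom (Polynomial.coeff q j) j)"
  by (rule poly_eqI) (use assms in \<open>auto simp: coeff_sum coeff_eq_0 cong: if_cong\<close>)

lemma poly_mod_sum: "(\<Sum>j\<in>A. g j) mod (p :: 'a::field poly) = (\<Sum>j\<in>A. g j mod p)"
  by (induct A rule: infinite_finite_induct) (auto simp: poly_mod_add_left)

text \<open>Reduction modulo \<open>p\<close> is linear over the base field, so a product is known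
  from the images of the monomials. The product formulas for both kinds of matrix rest on this
  expansion.\<close>

lemma coeff_mult_mod:
  assumes "Polynomial.degree q < n"
  shows "Polynomial.coeff (a * q mod (p :: 'a::field poly)) i =
    (\<Sum>j<n. Polynomial.coeff (a * Polynomial.monom 1 j mod p) i * Polynomial.coeff q j)"
proof -
  have "a * Polynomial.monom (Polynomial.coeff q j) j =
      Polynomial.smult (Polynomial.coeff q j) (a * Polynomial.monom 1 j)" for j
    by (metis mult_smult_right smult_monom mult.right_neutral)
  hence "a * q = (\<Sum>j<n. Polynomial.smult (Polynomial.coeff q j) (a * Polynomial.monom 1 j))"
    by (subst sum_monom_coeff[OF assms]) (simp add: sum_distrib_left)
  thus ?thesis
    by (simp add: poly_mod_sum coeff_sum mod_smult_left mult.commute)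
qed

locale quot_basis =
  fixes p :: "'a::field poly" and n :: nat
  assumes deg: "Polynomial.degree p = n" and pos: "n > 0"
begin

abbreviation M :: "'a poly \<Rightarrow> 'a mat" where "M \<equiv> mult_mat p"
abbreviation H :: "'a poly \<Rightarrow> 'a mat" where "H \<equiv> hankel p"
abbreviation xvar :: "'a poly" where "xvar \<equiv> Polynomial.monom 1 1"

lemma MC [simp]: "M a \<in> carrier_mat n n" and HC [simp]: "H a \<in> carrier_mat n n"
  using mult_mat_carrier[of p a] hankel_carrier[of p a] by (simp_all only: deg)

lemma dims [simp]: "dim_row (M a) = n" "dim_col (M a) = n" "dim_row (H a) = n" "dim_col (H a) = n"
  by (simp_all add: mult_mat_def hankel_def deg)

lemma p_nz: "p \<noteq> 0" using deg pos by auto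

lemma degree_mod: "Polynomial.degree (a mod p) < n"
  using degree_mod_less[OF p_nz, of a] deg pos by auto

lemma mod_cong_coeff:
  assumes "\<And>i. i < n \<Longrightarrow> Polynomial.coeff (a mod p) i = Polynomial.coeff (b mod p) i"
  shows "a mod p = b mod p"
proof (rule poly_eqI)
  fix i show "Polynomial.coeff (a mod p) i = Polynomial.coeff (b mod p) i"
    using assms[of i] degree_mod[of a] degree_mod[of b] by (cases "i < n") (auto simp: coeff_eq_0)
qed

lemma coords_mod_eq_iff: "coords n (a mod p) = coords n (b mod p) \<longleftrightarrow> a mod p = b mod p"
proof
  assume *: "coords n (a mod p) = coords n (b mod p)"
  show "a mod p = b mod p"
    by (rule mod_cong_coeff) (metis * coords_def index_vec)
qed simp

lemma mult_mat_vec: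
  assumes "Polynomial.degree q < n"
  shows "M a *\<^sub>v coords n q = coords n (a * q mod p)"
  by (rule eq_vecI)
    (auto simp: mult_mat_def coords_def deg scalar_prod_def coeff_mult_mod[OF assms] lessThan_atLeast0)

lemma coords_monom: "j < n \<Longrightarrow> coords n (Polynomial.monom 1 j) = unit_vec n j"
  by (rule eq_vecI) (auto simp: coords_def unit_vec_def)

lemma monom_mod: "j < n \<Longrightarrow> Polynomial.monom (1::'a) j mod p = Polynomial.monom 1 j"
  by (rule mod_poly_less) (simp add: degree_monom_eq deg)

lemma col_mult_mat: "j < n \<Longrightarrow> col (M a) j = coords n (a * Polynomial.monom 1 j mod p)"
  by (rule eq_vecI) (auto simp: mult_mat_def coords_def deg)

lemma mult_mat_mod: "a mod p = b mod p \<Longrightarrow> M a = M b"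
  unfolding mult_mat_def by (metis mod_mult_left_eq)

lemma hankel_mod: "a mod p = b mod p \<Longrightarrow> H a = H b"
  unfolding hankel_def by (metis mod_mult_left_eq)

lemma col0_mult_mat: "col (M a) 0 = coords n (a mod p)"
  using col_mult_mat[OF pos, of a] by (simp add: monom_eq_1)

lemma mult_mat_eq_iff: "M a = M b \<longleftrightarrow> a mod p = b mod p"
  by (metis mult_mat_mod col0_mult_mat coords_mod_eq_iff)

text \<open>Regular representation: reducing b x^j first and expanding it in monomials turns
  composition into the matrix product.\<close>

lemma mult_mat_mult: "M (a * b) = M a * M b"
proof (rule eq_matI)
  fix i j assume "i < dim_row (M a * M b)" "j < dim_col (M a * M b)"
  hence ij: "i < n" "j < n" by (simp_all add: mult_mat_def deg)
  have "Polynomial.coeff (a * b * Polynomial.monom 1 j mod p) i =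
      Polynomial.coeff (a * (b * Polynomial.monom 1 j mod p) mod p) i"
    by (simp add: mod_mult_right_eq mult.assoc)
  also have "\<dots> = (M a * M b) $$ (i, j)"
    unfolding coeff_mult_mod[OF degree_mod] using ij
    by (simp add: mult_mat_def deg scalar_prod_def lessThan_atLeast0)
  finally show "M (a * b) $$ (i, j) = (M a * M b) $$ (i, j)"
    using ij by (simp add: mult_mat_def deg)
qed (simp_all add: mult_mat_def deg)

text \<open>In \<phi>(a b x^i x^j) the factor x^i joins \<open>a\<close>, while b x^j is reduced and
  expanded as a column of \<open>M b\<close>. With \<open>a = 1\<close>, every form becomes the
  fixed form \<open>H 1\<close> followed by a multiplication.\<close>

lemma hankel_mult: "H (a * b) = H a * M b"
proof (rule eq_matI)
  fix i j assume "i < dim_row (H a * M b)" "j < dim_col (H a * M b)"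
  hence ij: "i < n" "j < n" by (simp_all add: mult_mat_def hankel_def deg)
  have "Polynomial.coeff (a * b * Polynomial.monom 1 (i + j) mod p) (n - 1) =
      Polynomial.coeff ((a * Polynomial.monom 1 i) * (b * Polynomial.monom 1 j mod p) mod p) (n - 1)"
    by (simp only: mod_mult_right_eq) (simp add: mult_ac mult_monom)
  also have "\<dots> = (H a * M b) $$ (i, j)"
    unfolding coeff_mult_mod[OF degree_mod] using ij
    by (simp add: mult_mat_def hankel_def deg scalar_prod_def lessThan_atLeast0 mult.assoc mult_monom)
  finally show "H (a * b) $$ (i, j) = (H a * M b) $$ (i, j)"
    using ij by (simp add: hankel_def deg)
qed (simp_all add: mult_mat_def hankel_def deg)

lemma mult_mat_1: "M 1 = 1\<^sub>m n"
  by (rule eq_matI) (auto simp: mult_mat_def deg monom_mod)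

lemma hankel_sym: "(H a)\<^sup>T = H a"
  by (rule eq_matI) (auto simp: hankel_def deg add.commute)

lemma mult_mat_commute: "M a * M b = M b * M a"
  by (metis mult_mat_mult mult.commute)

text \<open>Multiplication by \<open>b\<close> is self-adjoint for the form with Gram matrix \<open>H a\<close>.\<close>

lemma transpose_hankel_mult: "(M b)\<^sup>T * H a = H (a * b)"
  using transpose_mult[OF HC MC, of a b] by (simp add: hankel_sym hankel_mult[symmetric])

lemma hankel_congruence: "(M b)\<^sup>T * H a * M b = H (a * b\<^sup>2)"
  by (simp add: transpose_hankel_mult hankel_mult[symmetric] power2_eq_square mult.assoc)

text \<open>The residue of 1 generates the algebra under multiplication by x, so a commuting map is
  determined by its value there; column 0 of \<open>S\<close> supplies \<open>c\<close>.\<close>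

lemma commutes_imp_mult_mat:
  assumes S: "S \<in> carrier_mat n n" and comm: "S * M xvar = M xvar * S"
  obtains c where "S = M c"
proof -
  have "col S 0 \<in> carrier_vec n" using S by auto
  then obtain c where "Polynomial.degree c < n" "coords n c = col S 0"
    using coords_surj pos by blast
  hence c0: "col S 0 = coords n (c mod p)" by (simp add: mod_poly_less deg)
  have "col S j = coords n (c * Polynomial.monom 1 j mod p)" if "j < n" for j
    using that
  proof (induct j)
    case 0 thus ?case using c0 by (simp add: monom_eq_1)
  next
    case (Suc j)
    \<comment> \<open>Since j + 1 < n, no reduction takes place and x sends the basis vector x^j to
      the next one.\<close>
    have "col (M xvar) j = unit_vec n (Suc j)"
      using Suc by (simp add: col_mult_mat mult_monom monom_mod coords_monom)
    hence "col S (Suc j) = S *\<^sub>v col (M xvar) j"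
      using S Suc by (intro eq_vecI) auto
    also have "\<dots> = col (S * M xvar) j" using col_mult2[OF S MC, of j xvar] Suc by simp
    also have "\<dots> = M xvar *\<^sub>v col S j" using col_mult2[OF MC S, of j xvar] Suc comm by simp
    also have "\<dots> = coords n (xvar * (c * Polynomial.monom 1 j mod p) mod p)"
      using Suc by (simp add: mult_mat_vec degree_mod)
    also have "xvar * (c * Polynomial.monom 1 j mod p) mod p = c * Polynomial.monom 1 (Suc j) mod p"
      by (simp add: mod_mult_right_eq mult.left_commute mult_monom)
    finally show ?case .
  qed
  hence "S = M c"
    by (intro mat_col_eqI) (use S MC[of c] in \<open>auto simp: col_mult_mat\<close>)
  thus thesis by (rule that)
qed

text \<open>For the direction from the determinant to the inverse residue: the inverse matrix also
  commutes with multiplication by x, so it is again multiplication by a residue.\<close>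

lemma det_mult_mat_nz_iff: "det (M a) \<noteq> 0 \<longleftrightarrow> (\<exists>b. a * b mod p = 1 mod p)"
proof
  assume "\<exists>b. a * b mod p = 1 mod p"
  then obtain b where "M a * M b = 1\<^sub>m n"
    by (metis mult_mat_mult mult_mat_1 mult_mat_mod)
  hence "det (M a) * det (M b) = 1" by (metis det_mult MC det_one)
  thus "det (M a) \<noteq> 0" by auto
next
  assume "det (M a) \<noteq> 0"
  from det_non_zero_imp_unit[OF MC this, of n] obtain S where
    S: "S \<in> carrier_mat n n" "M a * S = 1\<^sub>m n" "S * M a = 1\<^sub>m n"
    by (auto simp: Units_def ring_mat_def)
  have "S * M xvar = S * M xvar * (M a * S)" by (simp add: S right_mult_one_mat[OF mult_carrier_mat[OF S(1) MC]])
  also have "\<dots> = S * (M xvar * M a) * S"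
    using S(1) by (simp add: assoc_mult_mat[of _ n n _ n _ n] mult_carrier_mat[of _ n n _ n])
  also have "M xvar * M a = M a * M xvar" by (rule mult_mat_commute)
  also have "S * (M a * M xvar) * S = (S * M a) * (M xvar * S)"
    using S(1) by (simp add: assoc_mult_mat[of _ n n _ n _ n] mult_carrier_mat[of _ n n _ n])
  also have "\<dots> = M xvar * S" by (simp add: S left_mult_one_mat[OF mult_carrier_mat[OF MC S(1)]])
  finally obtain b where "S = M b" using commutes_imp_mult_mat S(1) by blast
  thus "\<exists>b. a * b mod p = 1 mod p"
    using S(2) by (metis mult_mat_mult mult_mat_1 mult_mat_eq_iff)
qed

end

section \<open>Matrix cancellation and the sign of an order reversal\<close>

lemma inverse_matE:
  assumes "A \<in> carrier_mat n n" "det (A :: 'a::field mat) \<noteq> 0"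
  obtains B where "B \<in> carrier_mat n n" "A * B = 1\<^sub>m n" "B * A = 1\<^sub>m n"
  using det_non_zero_imp_unit[OF assms, of n] by (auto simp: Units_def ring_mat_def)

lemmas mat_assoc = assoc_mult_mat[of _ n n _ n _ n] mult_carrier_mat[of _ n n _ n] for n

lemma mat_left_cancel:
  assumes Q: "Q \<in> carrier_mat n n" "det (Q :: 'a::field mat) \<noteq> 0"
    and A: "A \<in> carrier_mat n n" "B \<in> carrier_mat n n" "Q * A = Q * B"
  shows "A = B"
proof -
  obtain K where K: "K \<in> carrier_mat n n" "K * Q = 1\<^sub>m n" using inverse_matE[OF Q] by metis
  have "K * Q * A = K * Q * B" using Q(1) A K(1) by (simp add: mat_assoc[where n = n])
  thus ?thesis using A K by simp
qed

text \<open>\<open>r k\<close> exchanges the outer \<open>k\<close> pairs of indices and fixes the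
  middle; each further pair costs one transposition. For even \<open>n\<close>, taking
  \<open>k = n div 2\<close> reverses everything.\<close>

lemma sign_reversal:
  assumes "2 * k \<le> n"
  defines "r \<equiv> \<lambda>k i. if i < k \<or> n - k \<le> i \<and> i < n then n - 1 - i else i"
  shows "r k permutes {0..<n} \<and> sign (r k) = (-1) ^ k"
  using assms(1)
proof (induct k)
  case 0
  have "r 0 = id" by (auto simp: r_def)
  thus ?case by (simp only: permutes_id sign_id power_0 simp_thms)
next
  case (Suc k)
  \<comment> \<open>\<open>r k\<close> still fixes both k and n - 1 - k, so the next pair is swapped
    independently.\<close>
  have eq: "r (Suc k) = Transposition.transpose k (n - 1 - k) \<circ> r k"
    using Suc.prems by (auto simp: fun_eq_iff r_def Transposition.transpose_def)
  have t: "Transposition.transpose k (n - 1 - k) permutes {0..<n}"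
    using Suc.prems by (intro permutes_swap_id) auto
  have r: "r k permutes {0..<n}" "sign (r k) = (-1) ^ k" using Suc by auto
  have "permutation (Transposition.transpose k (n - 1 - k))" "permutation (r k)"
    using t r permutation_permutes by blast+
  moreover have "k \<noteq> n - 1 - k" using Suc.prems by auto
  ultimately have "sign (r (Suc k)) = (-1) ^ Suc k"
    unfolding eq by (subst sign_compose) (simp_all add: sign_swap_id r(2))
  thus ?case using permutes_compose[OF r(1) t] unfolding eq by blast
qed

lemma poly_eq_sum:
  assumes "Polynomial.degree (q :: 'a::comm_ring_1 poly) < n"
  shows "poly q x = (\<Sum>i<n. Polynomial.coeff q i * x ^ i)"
  using arg_cong[OF sum_monom_coeff[OF assms], of "\<lambda>q. poly q x"] by (simp add: poly_sum poly_monom)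

lemma inj_comm_ring_hom_to_ac: "inj_comm_ring_hom (to_ac :: 'a::field \<Rightarrow> _)"
  by unfold_locales auto

section \<open>Hankel forms in even degree\<close>

locale even_quot_basis = quot_basis +
  assumes even: "even n"
begin

text \<open>\<phi>(x^m) is 0 for m < n - 1 and 1 for m = n - 1, so the Gram matrix vanishes above an
  antidiagonal of ones. Reversing its rows makes it upper unitriangular, and only the sign of the
  reversal remains.\<close>

lemma det_hankel_1: "det (H 1) = (-1) ^ (n div 2)"
proof -
  define r where "r i = (if i < n then n - 1 - i else i)" for i
  have "r = (\<lambda>i. if i < n div 2 \<or> n - n div 2 \<le> i \<and> i < n then n - 1 - i else i)"
    using even by (auto simp: fun_eq_iff r_def)
  hence r: "r permutes {0..<n}" "sign r = (-1) ^ (n div 2)"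
    using sign_reversal[of "n div 2" n] by simp_all
  let ?R = "mat n n (\<lambda>(i, j). H 1 $$ (r i, j))"
  \<comment> \<open>Only entries on and below the diagonal are computed: there the exponent is at
    most n - 1 and reduction is trivial.\<close>
  have entry: "?R $$ (i, j) = (if i = j then 1 else 0)" if "i < n" "j \<le> i" for i j
    using that by (auto simp: r_def hankel_def deg monom_mod)
  have "upper_triangular ?R" by (rule upper_triangularI) (subst entry, auto)
  moreover have "diag_mat ?R = replicate n 1"
    unfolding diag_mat_def by (rule nth_equalityI) (auto simp del: index_mat simp: entry)
  ultimately have "det ?R = 1"
    by (subst det_upper_triangular[of _ n]) auto
  hence "signof r * det (H 1) = 1"
    using det_permute_rows[OF HC r(1), of 1] by simp
  moreover have "signof r = ((-1) ^ (n div 2) :: 'a)" by (simp add: r(2))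
  ultimately have "(-1) ^ (n div 2) * ((-1) ^ (n div 2) * det (H 1)) = (-1) ^ (n div 2)" by simp
  thus ?thesis by (simp add: mult.assoc[symmetric] power_mult_distrib[symmetric])
qed

text \<open>Factoring \<open>H a\<close> as \<open>H 1 * M a\<close> turns a Gram determinant into a
  norm, up to sign.\<close>

lemma det_hankel: "det (H a) = (-1) ^ (n div 2) * det (M a)"
  using hankel_mult[of 1 a] det_mult[OF HC MC, of 1 a] by (simp add: det_hankel_1)

lemma hankel_eq_iff: "H a = H b \<longleftrightarrow> a mod p = b mod p"
proof
  assume "H a = H b"
  hence "H 1 * M a = H 1 * M b" using hankel_mult[of 1 a] hankel_mult[of 1 b] by simp
  moreover have "det (H 1) \<noteq> 0" by (simp add: det_hankel_1)
  ultimately have "M a = M b" using mat_left_cancel[OF HC _ MC MC] by blast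
  thus "a mod p = b mod p" by (simp add: mult_mat_eq_iff)
qed (rule hankel_mod)

text \<open>The equation for \<open>B * P\<close> says that A^-1 B acts as x in the basis
  \<open>P\<close>. Multiplication by x is self-adjoint for both \<open>G\<close> and
  \<open>H 1\<close>, so the inverse of \<open>H 1\<close> times \<open>G\<close> commutes with it
  and is multiplication by some \<open>a\<close>.\<close>

lemma pair_to_hankel:
  assumes A: "A \<in> carrier_mat n n" "A\<^sup>T = A" "det A \<noteq> 0"
    and B: "B \<in> carrier_mat n n" "B\<^sup>T = B"
    and P: "P \<in> carrier_mat n n" "det P \<noteq> 0" "B * P = A * P * M xvar"
  obtains a where "P\<^sup>T * A * P = H a" "P\<^sup>T * B * P = H (a * xvar)" "det (M a) \<noteq> 0"
proof -
  note [simp] = mat_assoc[where n = n]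
  define G where "G = P\<^sup>T * A * P"
  have G: "G \<in> carrier_mat n n" using A P by (simp add: G_def)
  have Gs: "G\<^sup>T = G" unfolding G_def
    using A P by (simp add: transpose_mult[of _ n n _ n])
  have GB: "P\<^sup>T * B * P = G * M xvar" using P A B by (simp add: G_def)
  have "(P\<^sup>T * B * P)\<^sup>T = P\<^sup>T * B * P"
    using B P(1) by (simp add: transpose_mult[of _ n n _ n])
  \<comment> \<open>The symmetry of both matrices in the new basis is self-adjointness of
    multiplication by x for \<open>G\<close>.\<close>
  hence GX: "(M xvar)\<^sup>T * G = G * M xvar"
    using GB G Gs by (simp add: transpose_mult[of _ n n _ n])
  obtain K where K: "K \<in> carrier_mat n n" "H 1 * K = 1\<^sub>m n" "K * H 1 = 1\<^sub>m n"
    using inverse_matE[OF HC, of 1] by (auto simp: det_hankel_1)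
  \<comment> \<open>Self-adjointness for \<open>H 1\<close>, rewritten for its inverse
    \<open>K\<close>.\<close>
  have "K * (M xvar)\<^sup>T = K * ((M xvar)\<^sup>T * H 1) * K" using K by simp
  also have "(M xvar)\<^sup>T * H 1 = H 1 * M xvar" by (simp add: transpose_hankel_mult hankel_mult[symmetric])
  also have "K * (H 1 * M xvar) * K = (K * H 1) * (M xvar * K)" using K(1) by simp
  also have "\<dots> = M xvar * K" using K by (simp only:) (simp add: K)
  finally have KX: "K * (M xvar)\<^sup>T = M xvar * K" .
  have "K * G * M xvar = K * (M xvar)\<^sup>T * G" using K G GX by simp
  also have "\<dots> = M xvar * (K * G)" unfolding KX using K G by simp
  finally have comm: "K * G * M xvar = M xvar * (K * G)" .
  obtain a where a: "K * G = M a" using commutes_imp_mult_mat[OF mult_carrier_mat[OF K(1) G] comm] .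
  have "G = H 1 * K * G" using K G by simp
  also have "\<dots> = H 1 * M a" unfolding a[symmetric] using K(1) G by simp
  finally have Ga: "G = H a" using hankel_mult[of 1 a] by simp
  \<comment> \<open>Congruence preserves nondegeneracy, which makes \<open>a\<close> a unit.\<close>
  have "det G = det P * det A * det P"
    unfolding G_def using A P by (simp add: det_mult[of _ n] det_transpose[of P n])
  hence "det (M a) \<noteq> 0" using A P Ga det_hankel[of a] by auto
  thus thesis using that Ga GB by (simp add: G_def hankel_mult)
qed

text \<open>Carrying one pair of forms to the other forces \<open>S\<close> to commute with
  multiplication by x, so it is multiplication by some \<open>c\<close>, and
  \<open>hankel_congruence\<close> reads off its effect on \<open>a\<close>.\<close>

lemma hankel_isometry:
  assumes S: "S \<in> carrier_mat n n" "S\<^sup>T * H a * S = H b" "S\<^sup>T * H (a * xvar) * S = H (b * xvar)"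
    and b: "det (M b) \<noteq> 0"
  obtains c where "S = M c" "b mod p = a * c\<^sup>2 mod p"
proof -
  note [simp] = mat_assoc[where n = n]
  have "det (S\<^sup>T * H a) * det S = det (H b)"
    unfolding S(2)[symmetric] using S(1) by (subst det_mult[of _ n]) auto
  hence nz: "det (S\<^sup>T * H a) \<noteq> 0" using b by (auto simp: det_hankel)
  \<comment> \<open>Both products equal \<open>H (b * xvar)\<close>; cancelling the invertible
    \<open>S\<^sup>T * H a\<close> leaves the commutation relation.\<close>
  have "S\<^sup>T * H a * (M xvar * S) = S\<^sup>T * H (a * xvar) * S"
    using S(1) by (simp add: hankel_mult)
  also have "\<dots> = S\<^sup>T * H a * S * M xvar" unfolding S(2,3) by (rule hankel_mult)
  also have "\<dots> = S\<^sup>T * H a * (S * M xvar)" using S(1) by simp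
  finally have "S\<^sup>T * H a * (M xvar * S) = S\<^sup>T * H a * (S * M xvar)" .
  hence "M xvar * S = S * M xvar"
    by (rule mat_left_cancel[OF _ nz, rotated -1]) (use S(1) in auto)
  hence "S * M xvar = M xvar * S" ..
  then obtain c where c: "S = M c" using commutes_imp_mult_mat[OF S(1)] by blast
  have "H b = H (a * c\<^sup>2)" using S(2) by (simp add: c hankel_congruence)
  thus thesis using c that by (simp add: hankel_eq_iff)
qed

text \<open>Every root of \<open>p\<close> in the algebraic closure is an eigenvalue of
  multiplication by x, and there are \<open>n\<close> of them. The difference of the two polynomials
  has degree below \<open>n\<close>, hence vanishes.\<close>

lemma char_poly_mult_mat_xvar:
  assumes sep: "card {x. poly (map_poly to_ac p) x = 0} = n"
  shows "Polynomial.smult (Polynomial.lead_coeff p) (char_poly (M xvar)) = p"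
proof (rule ccontr)
  interpret h: inj_comm_ring_hom "to_ac :: 'a \<Rightarrow> _" by (rule inj_comm_ring_hom_to_ac)
  interpret hp: map_poly_inj_comm_ring_hom "to_ac :: 'a \<Rightarrow> _" ..
  define q where "q = Polynomial.smult (Polynomial.lead_coeff p) (char_poly (M xvar)) - p"
  assume "\<not> ?thesis"
  hence q0: "q \<noteq> 0" by (simp add: q_def)
  have root: "poly (map_poly to_ac q) l = 0" if l: "poly (map_poly to_ac p) l = 0" for l
  proof -
    let ?T = "map_mat to_ac (M xvar)"
    \<comment> \<open>Evaluation of residues at \<open>l\<close>, written in the monomial basis. It
      is well defined because \<open>l\<close> is a root of \<open>p\<close>, and it is an
      eigenvector of the transpose.\<close>
    let ?v = "vec n (\<lambda>i. l ^ i)"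
    have T: "?T \<in> carrier_mat n n" by simp
    have "?T\<^sup>T *\<^sub>v ?v = l \<cdot>\<^sub>v ?v"
    proof (rule eq_vecI)
      fix j assume "j < dim_vec (l \<cdot>\<^sub>v ?v)"
      hence j: "j < n" by simp
      let ?r = "xvar * Polynomial.monom 1 j mod p"
      have "(?T\<^sup>T *\<^sub>v ?v) $ j = (\<Sum>i<n. to_ac (Polynomial.coeff ?r i) * l ^ i)"
        using j by (simp add: mult_mat_def deg scalar_prod_def lessThan_atLeast0)
      also have "\<dots> = poly (map_poly to_ac ?r) l"
        by (subst poly_eq_sum[of _ n]) (auto simp: degree_mod)
      also have "\<dots> = poly (map_poly to_ac (p * (xvar * Polynomial.monom 1 j div p) + ?r)) l"
        using l by (simp only: hom_distribs poly_add poly_mult) simp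
      also have "\<dots> = l * l ^ j"
        by (simp add: mult_monom poly_monom)
      finally show "(?T\<^sup>T *\<^sub>v ?v) $ j = (l \<cdot>\<^sub>v ?v) $ j" using j by simp
    qed (simp add: mult_mat_def deg)
    moreover have "?v \<noteq> 0\<^sub>v n"
    proof
      assume "?v = 0\<^sub>v n"
      hence "?v $ 0 = 0" using pos by (simp only: index_zero_vec)
      thus False using pos by simp
    qed
    ultimately have "eigenvalue ?T\<^sup>T l"
      unfolding eigenvalue_def eigenvector_def by (intro exI[of _ ?v]) (auto simp: mult_mat_def deg)
    hence "poly (char_poly ?T) l = 0"
      using eigenvalue_root_char_poly[of "?T\<^sup>T" n] char_poly_transpose_mat[OF T] T by simp
    thus ?thesis using l by (simp add: q_def h.char_poly_hom[OF MC] hom_distribs)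
  qed
  have m: "Polynomial.degree (char_poly (M xvar)) = n" "monic (char_poly (M xvar))"
    using degree_monic_char_poly[OF MC] by auto
  \<comment> \<open>The leading terms cancel because the characteristic polynomial is monic of
    degree \<open>n\<close>.\<close>
  have "Polynomial.degree q < n"
  proof (rule degree_lessI)
    show "\<forall>k\<ge>n. Polynomial.coeff q k = 0"
    proof safe
      fix k assume "n \<le> k"
      thus "Polynomial.coeff q k = 0"
        using m deg by (cases "k = n") (auto simp: q_def coeff_eq_0)
    qed
  qed (use pos in simp)
  moreover have "card {x. poly (map_poly to_ac p) x = 0} \<le> card {x. poly (map_poly to_ac q) x = 0}"
    using root q0 by (intro card_mono poly_roots_finite) auto
  moreover have "\<dots> \<le> Polynomial.degree q"
    using card_poly_roots_bound[of "map_poly to_ac q"] q0 by simp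
  ultimately show False using sep by simp
qed

end

subsection \<open>The invariant form as a characteristic polynomial\<close>

lemma coeff_binary_form:
  "Polynomial.coeff (binary_form n f) k = (if k \<le> n then Polynomial.monom (f (n - k)) (n - k) else 0)"
proof -
  have "Polynomial.coeff (binary_form n f) k = (\<Sum>i\<le>n. if i = n - k \<and> k \<le> n then Polynomial.monom (f i) i else 0)"
    unfolding binary_form_def coeff_sum by (rule sum.cong) auto
  thus ?thesis by auto
qed

lemma coeff_dehomogenize_binary_form:
  "Polynomial.coeff (dehomogenize (binary_form n f)) k = (if k \<le> n then f (n - k) else 0)"
  by (simp add: dehomogenize_def coeff_map_poly coeff_binary_form poly_monom)

lemma degree_dehomogenize_binary_form:
  assumes "f 0 \<noteq> 0"
  shows "Polynomial.degree (dehomogenize (binary_form n f)) = n"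
  by (rule antisym[OF degree_le le_degree]) (use assms in \<open>auto simp: coeff_dehomogenize_binary_form\<close>)

lemma inj_comm_ring_hom_const_poly: "inj_comm_ring_hom (\<lambda>c :: 'a::comm_ring_1. [:c:])"
  by unfold_locales auto

text \<open>Evaluation at x = 1, then y = 0, which isolates the coefficient f_0 of a form.\<close>

lemma comm_ring_hom_eval_10: "comm_ring_hom (\<lambda>F :: 'a::comm_ring_1 poly poly. poly (poly F 1) 0)"
  by unfold_locales auto

lemma comm_ring_hom_dehomogenize: "comm_ring_hom (dehomogenize :: 'a::field poly poly \<Rightarrow> _)"
proof -
  interpret comm_ring_hom "\<lambda>c :: 'a poly. poly c 1" by unfold_locales auto
  interpret map_poly_comm_ring_hom "\<lambda>c :: 'a poly. poly c 1" ..
  show ?thesis unfolding dehomogenize_def by (rule comm_ring_hom_axioms)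
qed

lemma dehomogenize_linear_form: "dehomogenize (linear_form a b) = [:b, a:]"
  by (rule poly_eqI)
    (simp add: dehomogenize_def linear_form_def coeff_map_poly coeff_pCons split: nat.splits)

text \<open>The substitution multiplies the coefficient of x^i by y^i, which can be
  cancelled.\<close>

lemma pcompose_xy_inj:
  assumes "pcompose F [:0, [:0, 1 :: 'a::field:]:] = pcompose G [:0, [:0, 1:]:]"
  shows "F = G"
proof (rule poly_eqI)
  fix i
  have "[:0, 1 :: 'a:] ^ i * Polynomial.coeff F i = [:0, 1:] ^ i * Polynomial.coeff G i"
    using arg_cong[OF assms, of "\<lambda>H. Polynomial.coeff H i"] by (simp add: coeff_pcompose_linear)
  thus "Polynomial.coeff F i = Polynomial.coeff G i" by simp
qed

lemma map_poly_const_linear: "map_poly (\<lambda>c. [:c:]) [:b, a:] = [:[:b:], [:a:]:]"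
  by (rule poly_eqI) (simp add: coeff_map_poly coeff_pCons split: nat.splits)

text \<open>Substituting \<open>x y\<close> for \<open>x\<close> turns a form of degree \<open>n\<close> into \<open>y\<^sup>n\<close> times its
  dehomogenization, so forms can be compared after setting \<open>y = 1\<close>.\<close>

lemma pcompose_xy_binary_form:
  "pcompose (binary_form n f) [:0, [:0, 1:]:] =
     Polynomial.smult ([:0, 1:] ^ n) (map_poly (\<lambda>c. [:c:]) (dehomogenize (binary_form n f)))"
proof (rule poly_eqI)
  fix i
  have "[:0, 1:] ^ i * Polynomial.monom (f (n - i)) (n - i) = Polynomial.smult (f (n - i)) ([:0, 1:] ^ n)"
    if "i \<le> n"
  proof -
    have "[:0, 1:] ^ i * Polynomial.monom (f (n - i)) (n - i) =
        Polynomial.smult (f (n - i)) ([:0, 1:] ^ i * [:0, 1:] ^ (n - i))"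
      by (simp add: monom_altdef)
    also have "[:0, 1 :: 'a:] ^ i * [:0, 1:] ^ (n - i) = [:0, 1:] ^ n"
      using that by (simp add: power_add[symmetric])
    finally show ?thesis .
  qed
  thus "Polynomial.coeff (pcompose (binary_form n f) [:0, [:0, 1:]:]) i =
      Polynomial.coeff (Polynomial.smult ([:0, 1:] ^ n)
        (map_poly (\<lambda>c. [:c:]) (dehomogenize (binary_form n f)))) i"
    by (simp add: coeff_pcompose_linear coeff_binary_form coeff_map_poly
        coeff_dehomogenize_binary_form del: pCons_0_0)
qed

definition pencil :: "'a::field mat \<Rightarrow> 'a mat \<Rightarrow> 'a poly mat" where \<comment> \<open>\<open>x A - B\<close>\<close>
  "pencil A B = mat (dim_row A) (dim_row A) (\<lambda>(i, j). [:- (B $$ (i, j)), A $$ (i, j):])"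

lemma dim_pencil: "dim_row (pencil A B) = dim_row A" "dim_col (pencil A B) = dim_row A"
  by (simp_all add: pencil_def)

text \<open>After the substitution every entry of A x - B y is divisible by y; the determinant gives
  up y^n and leaves that of the pencil, whose coefficients are free of y.\<close>

lemma pcompose_xy_invariant_form:
  assumes "A \<in> carrier_mat n n"
  shows "pcompose (invariant_form n (A, B)) [:0, [:0, 1:]:] =
     Polynomial.smult ([:0, 1:] ^ n) (map_poly (\<lambda>c. [:c:]) ((-1) ^ (n div 2) * det (pencil A B)))"
proof -
  interpret c: inj_comm_ring_hom "\<lambda>c :: 'a. [:c:]" by (rule inj_comm_ring_hom_const_poly)
  interpret e: map_poly_comm_ring_hom "\<lambda>c :: 'a. [:c:]" ..
  let ?L = "mat n n (\<lambda>(i, j). linear_form (A $$ (i, j)) (- (B $$ (i, j))))"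
  have "map_mat (\<lambda>F. pcompose F [:0, [:0, 1:]:]) ?L =
      [:[:0, 1:]:] \<cdot>\<^sub>m map_mat (map_poly (\<lambda>c. [:c:])) (pencil A B)"
    using assms by (intro eq_matI) (auto simp: linear_form_def pencil_def pcompose_pCons map_poly_const_linear)
  note L = this
  have "pcompose (det ?L) [:0, [:0, 1:]:] = det (map_mat (\<lambda>F. pcompose F [:0, [:0, 1:]:]) ?L)"
    by (rule comm_ring_hom.hom_det[OF pcompose_hom.comm_ring_hom_axioms, symmetric])
  also have "\<dots> = [:[:0, 1:]:] ^ n * det (map_mat (map_poly (\<lambda>c. [:c:])) (pencil A B))"
    unfolding L det_smult using assms by (simp only: index_map_mat dim_pencil carrier_matD)
  also have "\<dots> = [:[:0, 1:]:] ^ n * map_poly (\<lambda>c. [:c:]) (det (pencil A B))"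
    by (simp only: e.hom_det)
  finally have "pcompose (det ?L) [:0, [:0, 1:]:] = \<dots>" .
  thus ?thesis
    by (simp add: invariant_form_def pcompose_hom.hom_mult pcompose_hom.hom_power
        pcompose_hom.hom_uminus e.hom_mult e.hom_power e.hom_uminus poly_const_pow mult_ac)
qed

text \<open>Both sides of the first equation are forms of degree \<open>n\<close>, so nothing is
  lost by setting y = 1. The comparison is between polynomials and so holds over finite fields
  too.\<close>

lemma invariant_form_eq_iff:
  assumes "A \<in> carrier_mat n n"
  shows "invariant_form n (A, B) = binary_form n f \<longleftrightarrow>
    (-1) ^ (n div 2) * det (pencil A B) = dehomogenize (binary_form n f)"
proof -
  interpret c: inj_comm_ring_hom "\<lambda>c :: 'a. [:c:]" by (rule inj_comm_ring_hom_const_poly)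
  interpret e: map_poly_inj_comm_ring_hom "\<lambda>c :: 'a. [:c:]" ..
  have nz: "[:0, 1 :: 'a:] ^ n \<noteq> 0" by simp
  have "invariant_form n (A, B) = binary_form n f \<longleftrightarrow>
      pcompose (invariant_form n (A, B)) [:0, [:0, 1:]:] = pcompose (binary_form n f) [:0, [:0, 1:]:]"
    using pcompose_xy_inj by metis
  also have "\<dots> \<longleftrightarrow> map_poly (\<lambda>c. [:c:]) ((-1) ^ (n div 2) * det (pencil A B)) =
      map_poly (\<lambda>c. [:c:]) (dehomogenize (binary_form n f))"
    unfolding pcompose_xy_binary_form pcompose_xy_invariant_form[OF assms]
    by (rule iffI, erule smult_cancel[OF nz], simp)
  also have "\<dots> \<longleftrightarrow> (-1) ^ (n div 2) * det (pencil A B) = dehomogenize (binary_form n f)"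
    by (rule e.eq_iff)
  finally show ?thesis .
qed

lemma eval_10_binary_form: "poly (poly (binary_form n f) 1) 0 = f 0"
proof -
  have "poly (poly (binary_form n f) 1) 0 = (\<Sum>i\<le>n. if i = 0 then f i else 0)"
    unfolding binary_form_def poly_sum by (rule sum.cong) (auto simp: poly_monom)
  thus ?thesis by simp
qed

lemma det_eq_of_invariant_form:
  assumes "A \<in> carrier_mat n n" "invariant_form n (A, B) = binary_form n f"
  shows "(-1) ^ (n div 2) * det A = f 0"
proof -
  let ?L = "mat n n (\<lambda>(i, j). linear_form (A $$ (i, j)) (- (B $$ (i, j))))"
  have "poly (poly (det ?L) 1) 0 = det (map_mat (\<lambda>F. poly (poly F 1) 0) ?L)"
    by (rule comm_ring_hom.hom_det[OF comm_ring_hom_eval_10, symmetric])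
  also have "map_mat (\<lambda>F. poly (poly F 1) 0) ?L = A"
    using assms(1) by (intro eq_matI) (auto simp: linear_form_def)
  finally have "poly (poly (det ?L) 1) 0 = det A" .
  hence "poly (poly (invariant_form n (A, B)) 1) 0 = (-1) ^ (n div 2) * det A"
    by (simp add: invariant_form_def)
  thus ?thesis by (simp add: assms(2) eval_10_binary_form)
qed

text \<open>The matrix x A - A T factors as A (x - T).\<close>

lemma det_pencil:
  assumes A: "A \<in> carrier_mat n n" and T: "T \<in> carrier_mat n n"
  shows "det (pencil A (A * T)) = Polynomial.smult (det A) (char_poly T)"
proof -
  interpret c: inj_comm_ring_hom "\<lambda>c :: 'a. [:c:]" by (rule inj_comm_ring_hom_const_poly)
  have "pencil A (A * T) = map_mat (\<lambda>c. [:c:]) A * char_poly_matrix T"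
  proof (rule eq_matI)
    fix i j assume "i < dim_row (map_mat (\<lambda>c. [:c:]) A * char_poly_matrix T)"
      "j < dim_col (map_mat (\<lambda>c. [:c:]) A * char_poly_matrix T)"
    hence ij: "i < n" "j < n" using A T by (auto simp: char_poly_matrix_def)
    have "(map_mat (\<lambda>c. [:c:]) A * char_poly_matrix T) $$ (i, j) =
        (\<Sum>k<n. [:A $$ (i, k):] * ((if k = j then [:0, 1:] else 0) + [:- (T $$ (k, j)):]))"
      using A T ij by (auto simp: scalar_prod_def char_poly_matrix_def lessThan_atLeast0 intro!: sum.cong)
    also have "\<dots> = (\<Sum>k<n. if k = j then [:0, A $$ (i, k):] else 0) + (\<Sum>k<n. [:- (A $$ (i, k) * T $$ (k, j)):])"
      unfolding sum.distrib[symmetric] by (rule sum.cong) auto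
    also have "\<dots> = [:0, A $$ (i, j):] + [:- (A * T) $$ (i, j):]"
      using A T ij
      by (simp add: scalar_prod_def lessThan_atLeast0 sum_negf c.hom_sum[symmetric])
    finally show "pencil A (A * T) $$ (i, j) = (map_mat (\<lambda>c. [:c:]) A * char_poly_matrix T) $$ (i, j)"
      using A ij by (simp add: pencil_def)
  qed (use A T in \<open>auto simp: pencil_def char_poly_matrix_def\<close>)
  thus ?thesis
    using A T by (simp add: det_mult[of _ n] c.hom_det char_poly_def)
qed

text \<open>Since f(1, 0) is nonzero, no linear factor lacks its x-term, so each has the root -b_i /
  a_i; non-proportional factors give different roots.\<close>

lemma card_roots_separable:
  assumes f0: "f 0 \<noteq> (0::'a::field)" and sep: "separable_form n (binary_form n f)"
  shows "card {x. poly (map_poly to_ac (dehomogenize (binary_form n f))) x = 0} = n"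
proof -
  interpret h: inj_comm_ring_hom "to_ac :: 'a \<Rightarrow> _" by (rule inj_comm_ring_hom_to_ac)
  interpret hp: map_poly_inj_comm_ring_hom "to_ac :: 'a \<Rightarrow> _" ..
  interpret eh: comm_ring_hom "\<lambda>F :: 'a alg_closure poly poly. poly (poly F 1) 0"
    by (rule comm_ring_hom_eval_10)
  interpret dh: comm_ring_hom "dehomogenize :: 'a alg_closure poly poly \<Rightarrow> _"
    by (rule comm_ring_hom_dehomogenize)
  let ?F = "map_poly (map_poly to_ac) (binary_form n f)"
  let ?p = "dehomogenize (binary_form n f)"
  let ?R = "{x. poly (map_poly to_ac ?p) x = 0}"
  from sep obtain a b :: "nat \<Rightarrow> 'a alg_closure" where
    F: "?F = (\<Prod>i<n. linear_form (a i) (b i))" and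
    ne: "\<And>i j. i < n \<Longrightarrow> j < n \<Longrightarrow> i \<noteq> j \<Longrightarrow> a i * b j \<noteq> a j * b i"
    unfolding separable_form_def by blast
  have Fb: "?F = binary_form n (\<lambda>i. to_ac (f i))"
    by (rule poly_eqI) (auto simp: coeff_map_poly coeff_binary_form map_poly_monom)
  have "(\<Prod>i<n. a i) = poly (poly ?F 1) 0"
    by (simp add: F eh.hom_prod linear_form_def)
  hence "(\<Prod>i<n. a i) \<noteq> 0" using f0 by (simp add: Fb eval_10_binary_form)
  hence a0: "\<And>i. i < n \<Longrightarrow> a i \<noteq> 0" by auto
  have "dehomogenize ?F = map_poly to_ac ?p"
    by (rule poly_eqI) (simp add: Fb coeff_dehomogenize_binary_form coeff_map_poly)
  moreover have "dehomogenize ?F = (\<Prod>i<n. [:b i, a i:])"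
    by (simp add: F dh.hom_prod dehomogenize_linear_form)
  ultimately have p: "map_poly to_ac ?p = (\<Prod>i<n. [:b i, a i:])" by simp
  have "(\<lambda>i. - b i / a i) ` {..<n} \<subseteq> ?R"
  proof safe
    fix i assume "i < n"
    hence "poly [:b i, a i:] (- b i / a i) = 0" using a0 by simp
    thus "poly (map_poly to_ac ?p) (- b i / a i) = 0"
      unfolding p poly_prod using \<open>i < n\<close> by (intro prod_zero bexI[of _ i]) auto
  qed
  moreover have "inj_on (\<lambda>i. - b i / a i) {..<n}"
    using ne a0 by (auto simp: inj_on_def field_simps)
  moreover have p0: "?p \<noteq> 0" using f0 coeff_dehomogenize_binary_form[of n f n] by auto
  ultimately have "n \<le> card ?R"
    using card_mono[of ?R "(\<lambda>i. - b i / a i) ` {..<n}"] poly_roots_finite[of "map_poly to_ac ?p"]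
    by (simp add: card_image)
  moreover have "card ?R \<le> n"
    using card_poly_roots_bound[of "map_poly to_ac ?p"] p0 degree_dehomogenize_binary_form[of f n] f0 by simp
  ultimately show ?thesis by simp
qed

subsection \<open>Cyclic vectors\<close>

text \<open>Euclid's algorithm, with the gcd given as a combination and not normalised.\<close>

lemma poly_bezout: "\<exists>u w. u * a + w * b dvd a \<and> u * a + w * b dvd (b :: 'a::field poly)"
\<comment> \<open>The zero polynomial must rank below the nonzero constants, which the plain degree
  does not achieve.\<close>
proof (induct "if b = 0 then 0 else Suc (Polynomial.degree b)" arbitrary: a b rule: less_induct)
  case less
  show ?case
  proof (cases "b = 0")
    case True
    thus ?thesis by (intro exI[of _ 1] exI[of _ 0]) simp
  next
    case False
    have "(if a mod b = 0 then 0 else Suc (Polynomial.degree (a mod b))) <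
        (if b = 0 then 0 else Suc (Polynomial.degree b))"
      using degree_mod_less[OF False, of a] False by auto
    from less[OF this]
    obtain u w where *: "u * b + w * (a mod b) dvd b" "u * b + w * (a mod b) dvd a mod b"
      by blast
    have "u * b + w * (a mod b) = w * a + (u - w * (a div b)) * b"
      by (simp add: minus_div_mult_eq_mod[symmetric] algebra_simps)
    moreover have "u * b + w * (a mod b) dvd a"
      using *(1) *(2) by (rule dvd_mod_imp_dvd[rotated])
    ultimately show ?thesis using *(1) by metis
  qed
qed

text \<open>Euclid's lemma, with coprimality of \<open>a\<close> and \<open>b\<close> expressed by a
  Bezout identity.\<close>

lemma dvd_of_dvd_mult_const_combination:
  assumes "u * a + w * b = [:c:]" "(c :: 'a::field) \<noteq> 0" "a dvd b * r"
  shows "a dvd r"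
proof -
  have "Polynomial.smult c r = (u * a + w * b) * r" by (simp add: assms(1))
  also have "\<dots> = a * (u * r) + w * (b * r)" by (simp add: algebra_simps)
  finally have "a dvd Polynomial.smult c r" using assms(3) by simp
  thus ?thesis using assms(2) by (simp add: dvd_smult_iff)
qed

section \<open>Polynomials evaluated at a matrix\<close>

definition poly_mat :: "'a::comm_ring_1 mat \<Rightarrow> 'a poly \<Rightarrow> 'a mat" where
  "poly_mat T q = fold_coeffs (\<lambda>a S. a \<cdot>\<^sub>m 1\<^sub>m (dim_row T) + T * S) q (0\<^sub>m (dim_row T) (dim_row T))"

context
  fixes T :: "'a::field mat" and n :: nat
  assumes T: "T \<in> carrier_mat n n"
begin

lemma poly_mat_0: "poly_mat T 0 = 0\<^sub>m n n"
  using T by (simp add: poly_mat_def)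

text \<open>Horner's rule. \<open>pCons 0 0\<close> collapses to the zero polynomial, whose empty
  fold gives the zero matrix, so that case is separate.\<close>

lemma poly_mat_pCons: "poly_mat T (pCons a q) = a \<cdot>\<^sub>m 1\<^sub>m n + T * poly_mat T q"
proof (cases "a = 0 \<and> q = 0")
  case True
  thus ?thesis using T by (auto simp: poly_mat_0 intro!: eq_matI)
next
  case False
  thus ?thesis using T by (cases "a = 0") (auto simp: poly_mat_def)
qed

lemma poly_mat_carrier: "poly_mat T q \<in> carrier_mat n n"
  using T by (induct q) (auto simp: poly_mat_0 poly_mat_pCons)

lemma poly_mat_vec_pCons:
  assumes "v \<in> carrier_vec n"
  shows "poly_mat T (pCons a q) *\<^sub>v v = a \<cdot>\<^sub>v v + T *\<^sub>v (poly_mat T q *\<^sub>v v)"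
proof -
  have "(a \<cdot>\<^sub>m 1\<^sub>m n) *\<^sub>v v = a \<cdot>\<^sub>v v"
    using assms by (intro eq_vecI) auto
  thus ?thesis
    unfolding poly_mat_pCons using assms T poly_mat_carrier[of q]
    by (subst add_mult_distrib_mat_vec[of _ n n]) auto
qed

lemma poly_mat_vec_0: "v \<in> carrier_vec n \<Longrightarrow> poly_mat T 0 *\<^sub>v v = 0\<^sub>v n"
  by (auto simp: poly_mat_0 intro!: eq_vecI)

lemma poly_mat_vec_carrier [simp]: "v \<in> carrier_vec n \<Longrightarrow> poly_mat T q *\<^sub>v v \<in> carrier_vec n"
  using poly_mat_carrier mult_mat_vec_carrier by blast

lemma poly_mat_vec_add:
  assumes v: "v \<in> carrier_vec n"
  shows "poly_mat T (q + r) *\<^sub>v v = poly_mat T q *\<^sub>v v + poly_mat T r *\<^sub>v v"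
proof (induct q r rule: poly_induct2)
  case 0
  show ?case using v by (auto simp: poly_mat_vec_0)
next
  case (pCons a q b r)
  have c: "poly_mat T q *\<^sub>v v \<in> carrier_vec n" "poly_mat T r *\<^sub>v v \<in> carrier_vec n"
    "T *\<^sub>v (poly_mat T q *\<^sub>v v) \<in> carrier_vec n" "T *\<^sub>v (poly_mat T r *\<^sub>v v) \<in> carrier_vec n"
    using v T by auto
  show ?case
    unfolding add_pCons poly_mat_vec_pCons[OF v] pCons mult_add_distrib_mat_vec[OF T c(1,2)]
    by (rule eq_vecI) (use v c(3,4) T in \<open>auto simp: algebra_simps\<close>)
qed

lemma poly_mat_vec_smult:
  assumes v: "v \<in> carrier_vec n"
  shows "poly_mat T (Polynomial.smult c q) *\<^sub>v v = c \<cdot>\<^sub>v (poly_mat T q *\<^sub>v v)"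
proof (induct q)
  case 0
  show ?case using v by (auto simp: poly_mat_vec_0)
next
  case (pCons a q)
  have c: "poly_mat T q *\<^sub>v v \<in> carrier_vec n" "T *\<^sub>v (poly_mat T q *\<^sub>v v) \<in> carrier_vec n"
    using v T by auto
  show ?case
    unfolding smult_pCons poly_mat_vec_pCons[OF v] pCons mult_mat_vec[OF T c(1)]
    by (rule eq_vecI) (use v c T in \<open>auto simp: algebra_simps\<close>)
qed

text \<open>Together with additivity, this makes k^n a module over k[x] with x acting as
  \<open>T\<close>.\<close>

lemma poly_mat_vec_mult:
  assumes v: "v \<in> carrier_vec n"
  shows "poly_mat T (q * r) *\<^sub>v v = poly_mat T q *\<^sub>v (poly_mat T r *\<^sub>v v)"
proof (induct q)
  case 0
  show ?case using v by (auto simp: poly_mat_vec_0)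
next
  case (pCons a q)
  have "poly_mat T (pCons a q * r) *\<^sub>v v =
      poly_mat T (Polynomial.smult a r) *\<^sub>v v + poly_mat T (pCons 0 (q * r)) *\<^sub>v v"
    by (simp add: poly_mat_vec_add[OF v])
  also have "\<dots> = poly_mat T (pCons a q) *\<^sub>v (poly_mat T r *\<^sub>v v)"
    unfolding poly_mat_vec_pCons[OF v] poly_mat_vec_smult[OF v] pCons
      poly_mat_vec_pCons[OF poly_mat_vec_carrier[OF v]]
    by (rule eq_vecI) (use v T in auto)
  finally show ?case .
qed

lemma poly_mat_vec_const: "v \<in> carrier_vec n \<Longrightarrow> poly_mat T [:c:] *\<^sub>v v = c \<cdot>\<^sub>v v"
  using T by (auto simp: poly_mat_vec_pCons poly_mat_vec_0)

lemma poly_mat_vec_zero: "poly_mat T q *\<^sub>v 0\<^sub>v n = 0\<^sub>v n"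
  using poly_mat_carrier[of q] by auto

lemma poly_mat_vec_add_right:
  "v \<in> carrier_vec n \<Longrightarrow> w \<in> carrier_vec n \<Longrightarrow>
    poly_mat T q *\<^sub>v (v + w) = poly_mat T q *\<^sub>v v + poly_mat T q *\<^sub>v w"
  using mult_add_distrib_mat_vec[OF poly_mat_carrier] .

lemma poly_mat_vec_dvd:
  assumes "v \<in> carrier_vec n" "poly_mat T q *\<^sub>v v = 0\<^sub>v n" "q dvd r"
  shows "poly_mat T r *\<^sub>v v = 0\<^sub>v n"
  using assms by (metis dvdE mult.commute poly_mat_vec_mult poly_mat_vec_zero)

lemma poly_mat_eigenvector:
  assumes v: "v \<in> carrier_vec n" "T *\<^sub>v v = l \<cdot>\<^sub>v v"
  shows "poly_mat T q *\<^sub>v v = poly q l \<cdot>\<^sub>v v"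
proof (induct q)
  case 0
  show ?case using v by (auto simp: poly_mat_vec_0)
next
  case (pCons a q)
  show ?case
    unfolding poly_mat_vec_pCons[OF v(1)] pCons mult_mat_vec[OF T v(1)] v(2)
    by (rule eq_vecI) (use v in \<open>auto simp: algebra_simps\<close>)
qed

text \<open>q(T) v is linear in the coefficients of \<open>q\<close>, so it is obtained from the
  matrix with columns v, T v, T^2 v, ...\<close>

lemma poly_mat_vec_coords:
  assumes v: "v \<in> carrier_vec n" and q: "Polynomial.degree q < m" and i: "i < n"
  shows "(poly_mat T q *\<^sub>v v) $ i =
    (\<Sum>j<m. (poly_mat T (Polynomial.monom 1 j) *\<^sub>v v) $ i * Polynomial.coeff q j)"
proof -
  have sum: "(poly_mat T (\<Sum>j\<in>A. g j) *\<^sub>v v) $ i = (\<Sum>j\<in>A. (poly_mat T (g j) *\<^sub>v v) $ i)" for A :: "nat set" and g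
    by (induct A rule: infinite_finite_induct)
      (use i in \<open>auto simp: poly_mat_vec_0[OF v] poly_mat_vec_add[OF v] carrier_matD[OF poly_mat_carrier]
        simp del: index_mult_mat_vec\<close>)
  have mon: "(poly_mat T (Polynomial.monom c j) *\<^sub>v v) $ i = (poly_mat T (Polynomial.monom 1 j) *\<^sub>v v) $ i * c" for c j
    using arg_cong[OF poly_mat_vec_smult[OF v, of c "Polynomial.monom 1 j"], of "\<lambda>v. vec_index v i"] i
      poly_mat_carrier[of "Polynomial.monom 1 j"]
    by (simp add: smult_monom mult.commute del: index_mult_mat_vec)
  have "(poly_mat T q *\<^sub>v v) $ i =
      (poly_mat T (\<Sum>j<m. Polynomial.monom (Polynomial.coeff q j) j) *\<^sub>v v) $ i"
    using sum_monom_coeff[OF q] by (rule arg_cong)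
  also have "\<dots> = (\<Sum>j<m. (poly_mat T (Polynomial.monom 1 j) *\<^sub>v v) $ i * Polynomial.coeff q j)"
    unfolding sum by (rule sum.cong[OF refl mon])
  finally show ?thesis .
qed

end

text \<open>Singularity of q(T) can therefore be tested over the algebraic closure, where
  eigenvectors exist.\<close>

lemma poly_mat_to_ac:
  assumes "(T :: 'a::field mat) \<in> carrier_mat n n"
  shows "poly_mat (map_mat to_ac T) (map_poly to_ac q) = map_mat to_ac (poly_mat T q)"
proof (induct q)
  case 0
  show ?case using assms by (auto simp: poly_mat_0[of _ n] intro!: eq_matI)
next
  case (pCons a q)
  interpret h: inj_comm_ring_hom "to_ac :: 'a \<Rightarrow> _" by (rule inj_comm_ring_hom_to_ac)
  have "map_mat to_ac T \<in> carrier_mat n n" using assms by simp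
  note [simp] = poly_mat_pCons[OF assms] poly_mat_pCons[OF this]
  have c: "poly_mat T q \<in> carrier_mat n n" by (rule poly_mat_carrier[OF assms])
  have "map_mat to_ac (a \<cdot>\<^sub>m 1\<^sub>m n + T * poly_mat T q) =
      map_mat to_ac (a \<cdot>\<^sub>m 1\<^sub>m n) + map_mat to_ac (T * poly_mat T q)"
    by (rule eq_matI) (use assms c in \<open>auto simp: to_ac_add\<close>)
  also have "map_mat to_ac (a \<cdot>\<^sub>m 1\<^sub>m n) = to_ac a \<cdot>\<^sub>m 1\<^sub>m n"
    by (rule eq_matI) (auto simp: to_ac_mult)
  finally show ?case
    using pCons by (simp add: map_poly_pCons h.mat_hom_mult[OF assms c])
qed

text \<open>A squarefree \<open>q\<close> all of whose nonconstant factors are singular at \<open>T\<close> is the exact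
  annihilator of some vector: sum one kernel vector for each irreducible factor.\<close>

lemma exists_vector_with_annihilator:
  fixes T :: "'a::field mat"
  assumes T: "T \<in> carrier_mat n n" and p: "p \<noteq> 0"
    and sqf: "\<And>d. d * d dvd p \<Longrightarrow> Polynomial.degree d = 0"
    and sing: "\<And>d. d dvd p \<Longrightarrow> Polynomial.degree d > 0 \<Longrightarrow> det (poly_mat T d) = 0"
    and q: "q dvd p"
  shows "\<exists>v \<in> carrier_vec n. poly_mat T q *\<^sub>v v = 0\<^sub>v n \<and> (\<forall>r. poly_mat T r *\<^sub>v v = 0\<^sub>v n \<longrightarrow> q dvd r)"
  using q
proof (induct "Polynomial.degree q" arbitrary: q rule: less_induct)
  case less
  have q0: "q \<noteq> 0" using less.prems p by auto
  show ?case
  proof (cases "Polynomial.degree q = 0")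
    case True
    hence "is_unit q" using q0 by (simp add: is_unit_iff_degree)
    thus ?thesis
      by (intro bexI[of _ "0\<^sub>v n"]) (auto simp: poly_mat_vec_zero[OF T] unit_imp_dvd)
  next
    case False
    \<comment> \<open>A divisor of least positive degree; minimality serves as
      irreducibility.\<close>
    define \<pi> where "\<pi> = (ARG_MIN Polynomial.degree d. d dvd q \<and> Polynomial.degree d > 0)"
    have \<pi>: "\<pi> dvd q" "Polynomial.degree \<pi> > 0"
      and min: "\<And>d. d dvd q \<Longrightarrow> Polynomial.degree d > 0 \<Longrightarrow> Polynomial.degree \<pi> \<le> Polynomial.degree d"
      using arg_min_nat_lemma[of "\<lambda>d. d dvd q \<and> Polynomial.degree d > 0" q Polynomial.degree] False
      by (auto simp: \<pi>_def)
    obtain s where s: "q = \<pi> * s" using \<pi>(1) unfolding dvd_def by blast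
    have s0: "s \<noteq> 0" "\<pi> \<noteq> 0" using s q0 by auto
    have dvds: "s dvd p" "\<pi> dvd p" using s less.prems by (auto intro: dvd_trans)
    \<comment> \<open>A common divisor of \<pi> and \<open>s\<close> has its square dividing
      \<open>p\<close>, so the gcd is a nonzero constant.\<close>
    obtain u w where "u * \<pi> + w * s dvd \<pi>" "u * \<pi> + w * s dvd s" using poly_bezout by blast
    moreover from this have "(u * \<pi> + w * s) * (u * \<pi> + w * s) dvd p"
      using s less.prems by (meson dvd_trans mult_dvd_mono)
    hence "Polynomial.degree (u * \<pi> + w * s) = 0" by (rule sqf)
    ultimately obtain c where c: "u * \<pi> + w * s = [:c:]" "c \<noteq> 0"
      using s0 by (metis degree_eq_zeroE dvd_0_left pCons_0_0)
    have c': "w * s + u * \<pi> = [:c:]" using c by (simp add: add.commute)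
    have "Polynomial.degree s < Polynomial.degree q"
      using s s0 \<pi>(2) by (simp add: degree_mult_eq)
    from less.hyps[OF this dvds(1)] obtain y where
      y: "y \<in> carrier_vec n" "poly_mat T s *\<^sub>v y = 0\<^sub>v n"
        "\<And>r. poly_mat T r *\<^sub>v y = 0\<^sub>v n \<Longrightarrow> s dvd r" by blast
    from sing[OF dvds(2) \<pi>(2)] obtain z where
      z: "z \<in> carrier_vec n" "z \<noteq> 0\<^sub>v n" "poly_mat T \<pi> *\<^sub>v z = 0\<^sub>v n"
      using det_0_iff_vec_prod_zero_field[OF poly_mat_carrier[OF T]] by blast
    \<comment> \<open>The gcd of \<pi> and \<open>r\<close> kills \<open>z\<close>. It is not
      constant as \<open>z\<close> is nonzero, so by minimality it is an associate of \<pi>.\<close>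
    have z_ann: "\<pi> dvd r" if r: "poly_mat T r *\<^sub>v z = 0\<^sub>v n" for r
    proof -
      obtain a b where d: "a * \<pi> + b * r dvd \<pi>" "a * \<pi> + b * r dvd r" using poly_bezout by blast
      let ?d = "a * \<pi> + b * r"
      have dz: "poly_mat T ?d *\<^sub>v z = 0\<^sub>v n"
        using poly_mat_vec_dvd[OF T z(1,3), of "a * \<pi>"] poly_mat_vec_dvd[OF T z(1) r, of "b * r"]
        by (simp add: poly_mat_vec_add[OF T z(1)])
      obtain e where e: "\<pi> = ?d * e" using d(1) unfolding dvd_def by blast
      have de0: "?d \<noteq> 0" "e \<noteq> 0" using e s0 by auto
      have "Polynomial.degree ?d \<noteq> 0"
      proof
        assume "Polynomial.degree ?d = 0"
        then obtain k where k: "?d = [:k:]" by (rule degree_eq_zeroE)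
        hence "k \<cdot>\<^sub>v z = 0\<^sub>v n" using dz by (simp add: poly_mat_vec_const[OF T z(1)])
        moreover have "k \<noteq> 0" using k de0 by auto
        moreover have "inverse k \<cdot>\<^sub>v (k \<cdot>\<^sub>v z) = (inverse k * k) \<cdot>\<^sub>v z" by (simp add: smult_smult_assoc)
        ultimately have "z = inverse k \<cdot>\<^sub>v 0\<^sub>v n" by simp
        hence "z = 0\<^sub>v n" by auto
        thus False using z(2) by simp
      qed
      hence "Polynomial.degree \<pi> \<le> Polynomial.degree ?d"
        using min[of ?d] d(1) \<pi>(1) by (auto intro: dvd_trans)
      hence "Polynomial.degree e = 0"
        using arg_cong[OF e, of Polynomial.degree] degree_mult_eq[OF de0] by simp
      hence "is_unit e" using de0 by (simp add: is_unit_iff_degree)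
      hence "\<pi> dvd ?d" using e by (metis dvd_refl mult_unit_dvd_iff)
      thus ?thesis using d(2) by (rule dvd_trans)
    qed
    have yz: "y + z \<in> carrier_vec n" using y z by simp
    have ev: "poly_mat T r *\<^sub>v (y + z) = poly_mat T r *\<^sub>v y + poly_mat T r *\<^sub>v z" for r
      by (rule poly_mat_vec_add_right[OF T y(1) z(1)])
    show ?thesis
    proof (intro bexI[OF _ yz] conjI allI impI)
      show "poly_mat T q *\<^sub>v (y + z) = 0\<^sub>v n"
        using poly_mat_vec_dvd[OF T y(1,2), of q] poly_mat_vec_dvd[OF T z(1,3), of q]
        by (simp add: ev s)
    next
      fix r assume "poly_mat T r *\<^sub>v (y + z) = 0\<^sub>v n"
      note ann = poly_mat_vec_dvd[OF T yz this]
      \<comment> \<open>Multiplying by \<open>s\<close> kills the \<open>y\<close> part and isolates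
        \<open>z\<close>; multiplying by \<pi> will isolate \<open>y\<close>.\<close>
      have "poly_mat T (s * r) *\<^sub>v z = 0\<^sub>v n"
        using ann[of "s * r"] poly_mat_vec_dvd[OF T y(1,2), of "s * r"] z(1)
        by (simp add: ev poly_mat_vec_carrier[OF T])
      hence "\<pi> dvd r" using dvd_of_dvd_mult_const_combination[OF c] z_ann by blast
      then obtain t where t: "r = \<pi> * t" unfolding dvd_def by blast
      have "poly_mat T (\<pi> * r) *\<^sub>v y = 0\<^sub>v n"
        using ann[of "\<pi> * r"] poly_mat_vec_dvd[OF T z(1,3), of "\<pi> * r"] y(1)
        by (simp add: ev poly_mat_vec_carrier[OF T])
      hence "s dvd r" using dvd_of_dvd_mult_const_combination[OF c' c(2)] y(3) by blast
      hence "s dvd t" using dvd_of_dvd_mult_const_combination[OF c' c(2), of t] by (simp add: t)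
      thus "q dvd r" by (simp add: s t mult_dvd_mono)
    qed
  qed
qed

section \<open>A basis in which the operator becomes multiplication by x\<close>

context quot_basis
begin

text \<open>A polynomial d^2 e has the same roots as d e, whose degree is too small for
  \<open>n\<close> roots once \<open>d\<close> is nonconstant.\<close>

lemma squarefree_of_card_roots:
  assumes sep: "card {x. poly (map_poly to_ac p) x = 0} = n" and d: "d * d dvd p"
  shows "Polynomial.degree d = 0"
proof (rule ccontr)
  interpret h: inj_comm_ring_hom "to_ac :: 'a \<Rightarrow> _" by (rule inj_comm_ring_hom_to_ac)
  interpret hp: map_poly_inj_comm_ring_hom "to_ac :: 'a \<Rightarrow> _" ..
  assume dd: "Polynomial.degree d \<noteq> 0"
  from d obtain e where e: "p = d * d * e" unfolding dvd_def by blast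
  have nz: "d \<noteq> 0" "e \<noteq> 0" using e p_nz by auto
  have "{x. poly (map_poly to_ac p) x = 0} = {x. poly (map_poly to_ac (d * e)) x = 0}"
    by (auto simp: e hom_distribs)
  also have "card \<dots> \<le> Polynomial.degree (d * e)"
    using card_poly_roots_bound[of "map_poly to_ac (d * e)"] nz by simp
  also have "\<dots> < n" using dd nz deg e by (simp add: degree_mult_eq)
  finally show False using sep by simp
qed

text \<open>Over the closure a root of \<open>d\<close> is an eigenvalue of \<open>T\<close>, and
  d(T) kills its eigenvector.\<close>

lemma det_poly_mat_dvd_char_poly:
  assumes T: "T \<in> carrier_mat n n" and cp: "Polynomial.smult (Polynomial.lead_coeff p) (char_poly T) = p"
    and d: "d dvd p" "Polynomial.degree d > 0"
  shows "det (poly_mat T d) = 0"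
proof -
  interpret h: inj_comm_ring_hom "to_ac :: 'a \<Rightarrow> _" by (rule inj_comm_ring_hom_to_ac)
  interpret hp: map_poly_inj_comm_ring_hom "to_ac :: 'a \<Rightarrow> _" ..
  have T': "map_mat to_ac T \<in> carrier_mat n n" using T by simp
  obtain l where l: "poly (map_poly to_ac d) l = 0"
    using alg_closed_imp_poly_has_root[of "map_poly to_ac d"] d by auto
  hence "poly (map_poly to_ac p) l = 0" using d(1) by (auto elim!: dvdE simp: hom_distribs)
  hence "poly (char_poly (map_mat to_ac T)) l = 0"
    using p_nz by (subst (asm) cp[symmetric]) (simp add: h.char_poly_hom[OF T] hom_distribs)
  then obtain w where w: "w \<in> carrier_vec n" "w \<noteq> 0\<^sub>v n" "map_mat to_ac T *\<^sub>v w = l \<cdot>\<^sub>v w"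
    using eigenvalue_root_char_poly[OF T'] T unfolding eigenvalue_def eigenvector_def by auto
  have "poly_mat (map_mat to_ac T) (map_poly to_ac d) *\<^sub>v w = 0\<^sub>v n"
    using poly_mat_eigenvector[OF T' w(1,3)] l w(1) by auto
  hence "det (poly_mat (map_mat to_ac T) (map_poly to_ac d)) = 0"
    using det_0_iff_vec_prod_zero_field[OF poly_mat_carrier[OF T']] w by blast
  thus ?thesis by (simp add: poly_mat_to_ac[OF T])
qed

text \<open>A vector \<open>v\<close> with annihilator exactly (p) is cyclic: q -> q(T) v identifies
  k[x]/(p) with k^n, and \<open>P\<close> is the matrix of this map.\<close>

lemma similar_to_mult_mat:
  assumes sep: "card {x. poly (map_poly to_ac p) x = 0} = n"
    and T: "T \<in> carrier_mat n n" and cp: "Polynomial.smult (Polynomial.lead_coeff p) (char_poly T) = p"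
  obtains P where "P \<in> carrier_mat n n" "det P \<noteq> 0" "T * P = P * M xvar"
proof -
  obtain v where v: "v \<in> carrier_vec n" "poly_mat T p *\<^sub>v v = 0\<^sub>v n"
      "\<And>r. poly_mat T r *\<^sub>v v = 0\<^sub>v n \<Longrightarrow> p dvd r"
    using exists_vector_with_annihilator[OF T p_nz squarefree_of_card_roots[OF sep]
        det_poly_mat_dvd_char_poly[OF T cp] dvd_refl] by blast
  define P where "P = mat n n (\<lambda>(i, j). (poly_mat T (Polynomial.monom 1 j) *\<^sub>v v) $ i)"
  have P: "P \<in> carrier_mat n n" by (simp add: P_def)
  have Pq: "P *\<^sub>v coords n q = poly_mat T q *\<^sub>v v" if "Polynomial.degree q < n" for q
  proof (rule eq_vecI)
    fix i assume "i < dim_vec (poly_mat T q *\<^sub>v v)"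
    hence i: "i < n" using carrier_matD[OF poly_mat_carrier[OF T], of q] by simp
    show "(P *\<^sub>v coords n q) $ i = (poly_mat T q *\<^sub>v v) $ i"
      using i by (subst poly_mat_vec_coords[OF T v(1) that i])
        (simp add: P_def coords_def scalar_prod_def lessThan_atLeast0)
  qed (use poly_mat_carrier[OF T, of q] in \<open>simp add: P_def\<close>)
  have mod: "poly_mat T (q mod p) *\<^sub>v v = poly_mat T q *\<^sub>v v" for q
  proof -
    have "poly_mat T q *\<^sub>v v = poly_mat T (p * (q div p)) *\<^sub>v v + poly_mat T (q mod p) *\<^sub>v v"
      using poly_mat_vec_add[OF T v(1), of "p * (q div p)" "q mod p"] by simp
    also have "poly_mat T (p * (q div p)) *\<^sub>v v = 0\<^sub>v n"
      by (rule poly_mat_vec_dvd[OF T v(1,2)]) simp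
    finally show ?thesis using poly_mat_vec_carrier[OF T v(1), of "q mod p"] by simp
  qed
  have "det P \<noteq> 0"
  proof
    assume "det P = 0"
    then obtain w where w: "w \<in> carrier_vec n" "w \<noteq> 0\<^sub>v n" "P *\<^sub>v w = 0\<^sub>v n"
      using det_0_iff_vec_prod_zero_field[OF P] by blast
    obtain q where q: "Polynomial.degree q < n" "coords n q = w" using coords_surj[OF w(1) pos] .
    have "p dvd q" using v(3) Pq[OF q(1)] q(2) w(3) by simp
    hence "q = 0" using q(1) deg dvd_imp_degree_le[of p q] by (cases "q = 0") auto
    hence "w = 0\<^sub>v n" using q(2) by (auto simp: coords_def)
    thus False using w(2) by simp
  qed
  moreover have "T * P = P * M xvar"
  proof (rule mat_col_eqI)
    fix j assume "j < dim_col (P * M xvar)"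
    hence j: "j < n" by simp
    have colP: "col P j = poly_mat T (Polynomial.monom 1 j) *\<^sub>v v"
      using j poly_mat_carrier[OF T, of "Polynomial.monom 1 j"] by (intro eq_vecI) (auto simp: P_def)
    have "poly_mat T xvar *\<^sub>v y = T *\<^sub>v y" if "y \<in> carrier_vec n" for y
    proof -
      have "T *\<^sub>v 0\<^sub>v n = 0\<^sub>v n" "0 \<cdot>\<^sub>v y = 0\<^sub>v n" using that T by auto
      thus ?thesis using that T
        by (simp add: monom_Suc monom_0 one_pCons poly_mat_vec_pCons[OF T] poly_mat_vec_0[OF T])
    qed
    hence "col (T * P) j = poly_mat T xvar *\<^sub>v (poly_mat T (Polynomial.monom 1 j) *\<^sub>v v)"
      using col_mult2[OF T P j] colP poly_mat_vec_carrier[OF T v(1)] by simp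
    also have "\<dots> = poly_mat T (xvar * Polynomial.monom 1 j mod p) *\<^sub>v v"
      by (simp add: mod poly_mat_vec_mult[OF T v(1)])
    also have "\<dots> = P *\<^sub>v col (M xvar) j"
      using j by (simp add: col_mult_mat Pq degree_mod)
    also have "\<dots> = col (P * M xvar) j" using col_mult2[OF P MC j] by simp
    finally show "col (T * P) j = col (P * M xvar) j" .
  qed (use T P in auto)
  ultimately show thesis using that P by blast
qed

end

subsection \<open>Unit classes and orbits\<close>

text \<open>For \<open>cl\<close> the orbit map and \<open>F\<close> the square class: the choice
  made by \<open>inv_into\<close> is harmless because the fibres agree.\<close>

lemma bij_betw_quotient:
  assumes "\<And>v w. v \<in> V \<Longrightarrow> w \<in> V \<Longrightarrow> cl v = cl w \<longleftrightarrow> F v = F w"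
  shows "\<exists>\<Phi>. bij_betw \<Phi> (cl ` V) (F ` V)"
proof
  have *: "F (inv_into V cl (cl v)) = F v" if "v \<in> V" for v
    using assms[of "inv_into V cl (cl v)" v] that f_inv_into_f[of "cl v" cl V] inv_into_into[of "cl v" cl V] by auto
  show "bij_betw (\<lambda>C. F (inv_into V cl C)) (cl ` V) (F ` V)"
    unfolding bij_betw_def inj_on_def using * assms by (auto simp: image_image)
qed

lemma congruence_inverse:
  assumes Q: "Q \<in> carrier_mat n n" "K \<in> carrier_mat n n" "Q * K = 1\<^sub>m n"
    and W: "(W :: 'a::field mat) \<in> carrier_mat n n"
  shows "K\<^sup>T * (Q\<^sup>T * W * Q) * K = W"
proof -
  have "K\<^sup>T * Q\<^sup>T = 1\<^sub>m n" using transpose_mult[OF Q(1,2)] Q(3) by simp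
  moreover have "K\<^sup>T * (Q\<^sup>T * W * Q) * K = (K\<^sup>T * Q\<^sup>T) * W * (Q * K)"
    using Q(1,2) W by (simp add: mat_assoc[where n = n])
  ultimately show ?thesis using Q(3) W by simp
qed

lemma congruence_mult:
  assumes "P \<in> carrier_mat n n" "S \<in> carrier_mat n n" "(W :: 'a::field mat) \<in> carrier_mat n n"
  shows "(P * S)\<^sup>T * W * (P * S) = S\<^sup>T * (P\<^sup>T * W * P) * S"
  using assms by (simp add: transpose_mult[of _ n n _ n] mat_assoc[where n = n])

lemma det_congruence:
  assumes "P \<in> carrier_mat n n" "(W :: 'a::field mat) \<in> carrier_mat n n"
  shows "det (P\<^sup>T * W * P) = (det P)\<^sup>2 * det W"
  using assms by (simp add: det_mult[of _ n] det_transpose[of P n] power2_eq_square)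

lemma quot_class_eq_iff: "quot_class p a = quot_class p b \<longleftrightarrow> a mod p = b mod p"
proof
  assume "quot_class p a = quot_class p b"
  moreover have "a \<in> quot_class p a" by (simp add: quot_class_eq)
  ultimately show "a mod p = b mod p" by (simp add: quot_class_eq mod_eq_dvd_iff)
next
  assume "a mod p = b mod p"
  hence "c mod p = a mod p \<longleftrightarrow> c mod p = b mod p" for c by simp
  thus "quot_class p a = quot_class p b" by (auto simp: quot_class_eq mod_eq_dvd_iff)
qed

lemma one_quot_alg: "\<one>\<^bsub>quot_alg p\<^esub> = quot_class p 1"
  by (simp add: quot_alg_def quot_class_def FactRing_def rta_simps)

lemma quot_class_square: "quot_class p a [^]\<^bsub>quot_alg p\<^esub> (2::nat) = quot_class p (a\<^sup>2)"
proof -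
  interpret cring "quot_alg p" by (rule cring_quot_alg)
  have "quot_class p a \<in> carrier (quot_alg p)" by (simp add: carrier_quot_alg)
  thus ?thesis by (simp add: numeral_2_eq_2 mult_quot_class)
qed

section \<open>Units of k[x]/(p) and their square classes\<close>

context quot_basis
begin

lemma quot_class_Units_iff: "quot_class p a \<in> Units (quot_alg p) \<longleftrightarrow> det (M a) \<noteq> 0"
  unfolding det_mult_mat_nz_iff Units_def
  by (auto simp: carrier_quot_alg mult_quot_class one_quot_alg quot_class_eq_iff mult.commute)

lemma Units_quot_alg: "Units (quot_alg p) = {quot_class p a | a. det (M a) \<noteq> 0}"
proof -
  have "Units (quot_alg p) \<subseteq> range (quot_class p)"
    by (auto simp: Units_def carrier_quot_alg)
  thus ?thesis using quot_class_Units_iff by auto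
qed

abbreviation unit_class :: "'a poly \<Rightarrow> 'a poly set set" where
  "unit_class a \<equiv> square_class (quot_alg p) (quot_class p a)"

lemma unit_class_eq: "unit_class a = {quot_class p (a * c\<^sup>2) | c. det (M c) \<noteq> 0}"
  unfolding square_class_def unit_squares_def Units_quot_alg r_coset_def units_of_mult
  by (auto simp: quot_class_square mult_quot_class mult.commute) (metis mult_quot_class mult.commute quot_class_square)+

lemma det_mult_mat_mult: "det (M (a * b)) = det (M a) * det (M b)"
  unfolding mult_mat_mult by (rule det_mult[OF MC MC])

lemma det_mult_mat_square: "det (M (a * c\<^sup>2)) = det (M a) * (det (M c))\<^sup>2"
  by (simp add: det_mult_mat_mult power2_eq_square)

text \<open>The congruence itself forces \<open>c\<close> to be a unit, because norms are
  multiplicative and \<open>b\<close> has nonzero norm.\<close>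

lemma unit_class_eq_iff:
  assumes a: "det (M a) \<noteq> 0" and b: "det (M b) \<noteq> 0"
  shows "unit_class a = unit_class b \<longleftrightarrow> (\<exists>c. b mod p = a * c\<^sup>2 mod p)"
proof
  assume "unit_class a = unit_class b"
  moreover have "quot_class p b \<in> unit_class b"
    unfolding unit_class_eq by (rule CollectI, rule exI[of _ 1]) (simp add: mult_mat_1)
  ultimately have "quot_class p b \<in> unit_class a" by simp
  thus "\<exists>c. b mod p = a * c\<^sup>2 mod p" by (auto simp: unit_class_eq quot_class_eq_iff)
next
  assume "\<exists>c. b mod p = a * c\<^sup>2 mod p"
  then obtain c where c: "b mod p = a * c\<^sup>2 mod p" by blast
  have "det (M b) = det (M a) * (det (M c))\<^sup>2"
    using mult_mat_mod[OF c] by (simp add: det_mult_mat_square)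
  hence "det (M c) \<noteq> 0" using b by auto
  then obtain d where d: "c * d mod p = 1 mod p" using det_mult_mat_nz_iff by blast
  hence "d * c mod p = 1 mod p" by (simp add: mult.commute)
  hence dn: "det (M d) \<noteq> 0" using det_mult_mat_nz_iff by blast
  have cd: "quot_class p (x * (c\<^sup>2 * d\<^sup>2)) = quot_class p x" for x
  proof -
    have "x * (c\<^sup>2 * d\<^sup>2) mod p = x * (c * d) * (c * d) mod p" by (simp add: power2_eq_square mult_ac)
    also have "\<dots> = x mod p" using d by (metis mod_mult_right_eq mult.right_neutral)
    finally show ?thesis by (simp add: quot_class_eq_iff)
  qed
  have bc: "quot_class p (b * x) = quot_class p (a * c\<^sup>2 * x)" for x
    unfolding quot_class_eq_iff by (metis c mod_mult_left_eq)
  show "unit_class a = unit_class b"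
  proof (intro equalityI subsetI)
    fix u assume "u \<in> unit_class a"
    then obtain e where e: "u = quot_class p (a * e\<^sup>2)" "det (M e) \<noteq> 0" by (auto simp: unit_class_eq)
    have "u = quot_class p (b * (d * e)\<^sup>2)"
      using cd[of "a * e\<^sup>2"] by (simp add: e bc power_mult_distrib mult_ac)
    thus "u \<in> unit_class b" using e(2) dn by (auto simp: unit_class_eq det_mult_mat_mult)
  next
    fix u assume "u \<in> unit_class b"
    then obtain e where e: "u = quot_class p (b * e\<^sup>2)" "det (M e) \<noteq> 0" by (auto simp: unit_class_eq)
    have "u = quot_class p (a * (c * e)\<^sup>2)"
      by (simp add: e bc power_mult_distrib mult_ac)
    thus "u \<in> unit_class a" using e(2) \<open>det (M c) \<noteq> 0\<close> by (auto simp: unit_class_eq det_mult_mat_mult)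
  qed
qed

text \<open>Within a class the norm changes only by nonzero squares, so one representative decides
  membership.\<close>

lemma norm_classes_eq:
  assumes c: "c \<noteq> 0"
  shows "norm_classes p c = {unit_class a | a. \<exists>d. d \<noteq> 0 \<and> det (M a) = c * d\<^sup>2}"
proof -
  have car: "carrier (units_mod_squares (quot_alg p)) = {unit_class a | a. det (M a) \<noteq> 0}"
    unfolding units_mod_squares_def FactGroup_def RCOSETS_def square_class_def
    by (auto simp: units_of_carrier Units_quot_alg)
  have "quot_norm p ` unit_class a \<subseteq> square_class ring_of_type_algebra c \<longleftrightarrow>
      (\<exists>d. d \<noteq> 0 \<and> det (M a) = c * d\<^sup>2)" for a
  proof
    have "quot_class p a \<in> unit_class a"
      unfolding unit_class_eq by (rule CollectI, rule exI[of _ 1]) (simp add: mult_mat_1)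
    moreover assume "quot_norm p ` unit_class a \<subseteq> square_class ring_of_type_algebra c"
    ultimately have "det (M a) \<in> square_class ring_of_type_algebra c"
      by (metis image_subset_iff quot_norm_eq_det)
    thus "\<exists>d. d \<noteq> 0 \<and> det (M a) = c * d\<^sup>2" by (auto simp: square_class_field[OF c])
  next
    assume "\<exists>d. d \<noteq> 0 \<and> det (M a) = c * d\<^sup>2"
    then obtain d where d: "d \<noteq> 0" "det (M a) = c * d\<^sup>2" by blast
    show "quot_norm p ` unit_class a \<subseteq> square_class ring_of_type_algebra c"
    proof safe
      fix u assume "u \<in> unit_class a"
      then obtain e where e: "u = quot_class p (a * e\<^sup>2)" "det (M e) \<noteq> 0" by (auto simp: unit_class_eq)
      have "quot_norm p u = c * (d * det (M e))\<^sup>2"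
        by (simp add: e quot_norm_eq_det det_mult_mat_square d power_mult_distrib)
      thus "quot_norm p u \<in> square_class ring_of_type_algebra c"
        using d(1) e(2) by (auto simp: square_class_field[OF c] intro!: exI[of _ "d * det (M e)"])
    qed
  qed
  thus ?thesis using c unfolding norm_classes_def car by auto
qed

end

section \<open>The action on symmetric pairs\<close>

lemma carrier_SLpm: "g \<in> carrier (SLpm n) \<longleftrightarrow> g \<in> carrier_mat n n \<and> (det g = 1 \<or> det g = -1)"
  by (simp add: SLpm_def)

lemma pair_act_mult:
  assumes "g \<in> carrier_mat n n" "h \<in> carrier_mat n n" "v \<in> sym_pairs n"
  shows "pair_act (g * h) v = pair_act g (pair_act h v)"
  using assms
  by (auto simp: pair_act_def sym_pairs_def transpose_mult[of _ n n _ n] mat_assoc[where n = n])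

lemma pair_act_one: "v \<in> sym_pairs n \<Longrightarrow> pair_act (1\<^sub>m n) v = v"
  by (auto simp: pair_act_def sym_pairs_def)

lemma orbit_SLpm_eq_iff:
  assumes v: "v \<in> sym_pairs n" and w: "w \<in> sym_pairs n"
  shows "orbit (SLpm n) pair_act v = orbit (SLpm n) pair_act w \<longleftrightarrow>
    (\<exists>g \<in> carrier (SLpm n). pair_act g v = w)"
proof
  interpret group "SLpm n" by (rule group_SLpm)
  have mult: "g * h = g \<otimes>\<^bsub>SLpm n\<^esub> h" for g h :: "'a mat" by (simp add: SLpm_def)
  {
    assume "orbit (SLpm n) pair_act v = orbit (SLpm n) pair_act w"
    moreover have "w \<in> orbit (SLpm n) pair_act w"
      using pair_act_one[OF w] one_closed by (auto simp: orbit_def SLpm_def intro!: exI[of _ "1\<^sub>m n"])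
    ultimately have "w \<in> orbit (SLpm n) pair_act v" by simp
    thus "\<exists>g \<in> carrier (SLpm n). pair_act g v = w" by (auto simp: orbit_def)
  next
    assume "\<exists>g \<in> carrier (SLpm n). pair_act g v = w"
    then obtain g where g: "g \<in> carrier (SLpm n)" "pair_act g v = w" by blast
    have gc: "h \<in> carrier_mat n n" if "h \<in> carrier (SLpm n)" for h :: "'a mat"
      using that by (simp add: carrier_SLpm)
    have 1: "pair_act h w = pair_act (h * g) v" if "h \<in> carrier (SLpm n)" for h
      using pair_act_mult[OF gc[OF that] gc[OF g(1)] v] g(2) by simp
    \<comment> \<open>\<open>h\<close> is factored through \<open>g\<close>, so that points of the
      orbit of \<open>v\<close> are reached from \<open>w\<close>.\<close>
    have 2: "pair_act h v = pair_act (h * inv\<^bsub>SLpm n\<^esub> g) w" if "h \<in> carrier (SLpm n)" for h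
    proof -
      have "h * inv\<^bsub>SLpm n\<^esub> g * g = h"
        unfolding mult using that g(1) by (simp add: m_assoc)
      thus ?thesis using 1[of "h * inv\<^bsub>SLpm n\<^esub> g"] that g(1) by (simp add: mult)
    qed
    show "orbit (SLpm n) pair_act v = orbit (SLpm n) pair_act w"
    proof (intro equalityI subsetI)
      fix x assume "x \<in> orbit (SLpm n) pair_act v"
      then obtain h where "h \<in> carrier (SLpm n)" "x = pair_act h v" by (auto simp: orbit_def)
      thus "x \<in> orbit (SLpm n) pair_act w"
        using 2[of h] g(1) mult by (auto simp: orbit_def intro!: exI[of _ "h * inv\<^bsub>SLpm n\<^esub> g"])
    next
      fix x assume "x \<in> orbit (SLpm n) pair_act w"
      then obtain h where "h \<in> carrier (SLpm n)" "x = pair_act h w" by (auto simp: orbit_def)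
      thus "x \<in> orbit (SLpm n) pair_act v"
        using 1[of h] g(1) mult by (auto simp: orbit_def intro!: exI[of _ "h * g"])
    qed
  }
qed

section \<open>Pairs with a given invariant form and their Hankel bases\<close>

locale separable_binary_form =
  fixes n :: nat and f :: "nat \<Rightarrow> 'a::field"
  assumes n2: "n \<ge> 2" and even_n: "even n" and f0: "f 0 \<noteq> 0"
    and sep: "separable_form n (binary_form n f)"
begin

abbreviation p :: "'a poly" where "p \<equiv> dehomogenize (binary_form n f)"

sublocale even_quot_basis p n
  using n2 even_n degree_dehomogenize_binary_form[of f n] f0 by unfold_locales auto

definition V :: "('a mat \<times> 'a mat) set" where
  "V = {v \<in> sym_pairs n. invariant_form n v = binary_form n f}"

text \<open>The columns of \<open>P\<close> identify k^n with k[x]/(p) so that the two forms of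
  \<open>v\<close> become \<phi>(a u w) and \<phi>(a x u w). The group acts by g A g^t and a basis
  change by P^t A P, which is why transposes of \<open>g\<close> appear below.\<close>

definition represents :: "'a mat \<times> 'a mat \<Rightarrow> 'a mat \<Rightarrow> 'a poly \<Rightarrow> bool" where
  "represents v P a \<longleftrightarrow> P \<in> carrier_mat n n \<and> det P \<noteq> 0 \<and> det (M a) \<noteq> 0 \<and>
     P\<^sup>T * fst v * P = H a \<and> P\<^sup>T * snd v * P = H (a * xvar)"

lemma lead_coeff_p: "Polynomial.lead_coeff p = f 0"
  by (simp add: deg coeff_dehomogenize_binary_form)

lemma sign_square: "(-1) ^ (n div 2) * ((-1) ^ (n div 2) * x) = (x :: 'a)"
  by (simp add: mult.assoc[symmetric] power_mult_distrib[symmetric])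

lemma V_D:
  assumes "v \<in> V"
  shows "fst v \<in> carrier_mat n n" "snd v \<in> carrier_mat n n" "(fst v)\<^sup>T = fst v" "(snd v)\<^sup>T = snd v"
    "det (fst v) = (-1) ^ (n div 2) * f 0" "det (fst v) \<noteq> 0"
proof -
  show *: "fst v \<in> carrier_mat n n" "snd v \<in> carrier_mat n n" "(fst v)\<^sup>T = fst v" "(snd v)\<^sup>T = snd v"
    using assms by (auto simp: V_def sym_pairs_def)
  have "(-1) ^ (n div 2) * det (fst v) = f 0"
    using assms * by (intro det_eq_of_invariant_form[of _ n "snd v"]) (auto simp: V_def)
  thus "det (fst v) = (-1) ^ (n div 2) * f 0" using sign_square[of "det (fst v)"] by simp
  thus "det (fst v) \<noteq> 0" using f0 by simp
qed

text \<open>By \<open>det_pencil\<close>, T = A^-1 B has characteristic polynomial p / f_0, so a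
  cyclic basis exists and \<open>pair_to_hankel\<close> applies in it.\<close>

lemma represents_exists:
  assumes v: "v \<in> V"
  shows "\<exists>P a. represents v P a"
proof -
  note vD = V_D[OF v]
  let ?A = "fst v" and ?B = "snd v"
  obtain K where K: "K \<in> carrier_mat n n" "?A * K = 1\<^sub>m n" "K * ?A = 1\<^sub>m n"
    using inverse_matE[OF vD(1,6)] by metis
  define T where "T = K * ?B"
  have T: "T \<in> carrier_mat n n" using K vD by (simp add: T_def)
  have "?A * T = (?A * K) * ?B" using K(1) vD(1,2) by (simp add: T_def mat_assoc[where n = n])
  hence AT: "?A * T = ?B" using K vD(2) by simp
  have "(-1) ^ (n div 2) * Polynomial.smult (det ?A) (char_poly T) = p"
    using v invariant_form_eq_iff[OF vD(1), of ?B f] det_pencil[OF vD(1) T] by (simp add: V_def AT)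
  moreover have "(-1) ^ (n div 2) * Polynomial.smult (det ?A) q = Polynomial.smult ((-1) ^ (n div 2) * det ?A) q" for q
    by (cases "even (n div 2)") simp_all
  ultimately have "Polynomial.smult (Polynomial.lead_coeff p) (char_poly T) = p"
    unfolding lead_coeff_p by (simp add: vD(5) sign_square)
  then obtain P where P: "P \<in> carrier_mat n n" "det P \<noteq> 0" "T * P = P * M xvar"
    using similar_to_mult_mat[OF card_roots_separable[OF f0 sep] T] by blast
  have "?B * P = ?A * (T * P)"
    unfolding AT[symmetric] using vD(1) T P(1) by (simp add: mat_assoc[where n = n])
  also have "\<dots> = ?A * P * M xvar" unfolding P(3) using vD(1) P(1) by (simp add: mat_assoc[where n = n])
  finally obtain a where "P\<^sup>T * ?A * P = H a" "P\<^sup>T * ?B * P = H (a * xvar)" "det (M a) \<noteq> 0"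
    using pair_to_hankel[OF vD(1,3,6,2,4) P(1,2)] by blast
  thus ?thesis using P unfolding represents_def by blast
qed

text \<open>Determinants of P^t A P = \<open>H a\<close>: the sign of det A cancels that of the
  Hankel form, which gives the norm condition.\<close>

lemma det_represents:
  assumes "v \<in> V" "represents v P a"
  shows "det (M a) = f 0 * (det P)\<^sup>2"
proof -
  have P: "P \<in> carrier_mat n n" "P\<^sup>T * fst v * P = H a" using assms(2) by (auto simp: represents_def)
  have "(-1) ^ (n div 2) * det (M a) = (det P)\<^sup>2 * ((-1) ^ (n div 2) * f 0)"
    using det_congruence[OF P(1) V_D(1)[OF assms(1)]] by (simp add: P(2) det_hankel V_D(5)[OF assms(1)])
  hence "(-1) ^ (n div 2) * ((-1) ^ (n div 2) * det (M a)) =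
      (-1) ^ (n div 2) * ((-1) ^ (n div 2) * (f 0 * (det P)\<^sup>2))" by (simp add: mult_ac)
  thus ?thesis by (simp only: sign_square)
qed

text \<open>The forms \<open>H a\<close> and \<open>H (a * xvar)\<close> are transported by the
  inverse of a matrix of determinant \<open>d\<close>, which brings the first determinant to the
  prescribed (-1)^(n/2) f_0.\<close>

lemma represents_surj:
  assumes a: "det (M a) = f 0 * d\<^sup>2" and d: "d \<noteq> 0"
  shows "\<exists>v \<in> V. \<exists>P. represents v P a"
proof -
  \<comment> \<open>Any matrix of determinant \<open>d\<close> would serve; this one scales a single
    coordinate.\<close>
  define P where "P = multrow_mat n 0 d"
  have P: "P \<in> carrier_mat n n" "det P = d" using pos by (simp_all add: P_def det_multrow_mat)
  obtain Q where Q: "Q \<in> carrier_mat n n" "P * Q = 1\<^sub>m n" "Q * P = 1\<^sub>m n"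
    using inverse_matE[OF P(1)] P(2) d by metis
  have "det P * det Q = 1" using det_mult[OF P(1) Q(1)] Q(2) by simp
  hence dQ: "d * det Q = 1" using P(2) by simp
  define A where "A = Q\<^sup>T * H a * Q"
  define B where "B = Q\<^sup>T * H (a * xvar) * Q"
  define T where "T = P * M xvar * Q"
  have c: "A \<in> carrier_mat n n" "B \<in> carrier_mat n n" "T \<in> carrier_mat n n"
    using Q P by (auto simp: A_def B_def T_def)
  have s: "A\<^sup>T = A" "B\<^sup>T = B" using Q(1)
    by (simp_all add: A_def B_def transpose_mult[of _ n n _ n] mat_assoc[where n = n] hankel_sym)
  have "A * T = Q\<^sup>T * H a * (Q * P) * M xvar * Q"
    using Q(1) P(1) by (simp add: A_def T_def mat_assoc[where n = n])
  also have "\<dots> = B" using Q by (simp add: B_def hankel_mult mat_assoc[where n = n])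
  finally have AT: "A * T = B" .
  have "similar_mat T (M xvar)"
    by (rule similar_matI[of _ _ P Q n]) (use P Q c in \<open>auto simp: T_def\<close>)
  hence cp: "char_poly T = char_poly (M xvar)" by (rule char_poly_similar)
  have "det A = (det Q)\<^sup>2 * ((-1) ^ (n div 2) * (f 0 * d\<^sup>2))"
    unfolding A_def det_congruence[OF Q(1) HC] det_hankel a ..
  also have "\<dots> = (-1) ^ (n div 2) * f 0 * (d * det Q)\<^sup>2" by (simp add: power_mult_distrib mult_ac)
  finally have dA: "det A = (-1) ^ (n div 2) * f 0" by (simp add: dQ)
  have "det (pencil A B) = Polynomial.smult ((-1) ^ (n div 2)) (Polynomial.smult (f 0) (char_poly (M xvar)))"
    using det_pencil[OF c(1,3)] by (simp add: AT cp dA)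
  also have "Polynomial.smult (f 0) (char_poly (M xvar)) = p"
    using char_poly_mult_mat_xvar[OF card_roots_separable[OF f0 sep]] by (simp only: lead_coeff_p)
  finally have "(-1) ^ (n div 2) * det (pencil A B) = p"
    by (cases "even (n div 2)") simp_all
  hence "(A, B) \<in> V" using c s invariant_form_eq_iff[OF c(1)] by (auto simp: V_def sym_pairs_def)
  moreover have "represents (A, B) P a"
    using congruence_inverse[OF Q(1) P(1) Q(3) HC] P d a f0
    by (simp add: represents_def A_def B_def)
  ultimately show ?thesis by blast
qed

text \<open>Two such bases of one pair differ by an isometry of Hankel forms, to which
  \<open>hankel_isometry\<close> applies.\<close>

lemma represents_change_basis:
  assumes v: "v \<in> V" "represents v P a" and R: "R \<in> carrier_mat n n"
    and b: "R\<^sup>T * fst v * R = H b" "R\<^sup>T * snd v * R = H (b * xvar)" "det (M b) \<noteq> 0"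
  obtains c where "R = P * M c" "b mod p = a * c\<^sup>2 mod p"
proof -
  have P: "P \<in> carrier_mat n n" "det P \<noteq> 0" "P\<^sup>T * fst v * P = H a" "P\<^sup>T * snd v * P = H (a * xvar)"
    using v(2) by (auto simp: represents_def)
  obtain Q where Q: "Q \<in> carrier_mat n n" "P * Q = 1\<^sub>m n" using inverse_matE[OF P(1,2)] by metis
  define S where "S = Q * R"
  have S: "S \<in> carrier_mat n n" using Q R by (simp add: S_def)
  have "P * S = (P * Q) * R" using P(1) Q(1) R by (simp add: S_def mat_assoc[where n = n])
  hence PS: "P * S = R" using Q R by simp
  have "S\<^sup>T * H a * S = H b" "S\<^sup>T * H (a * xvar) * S = H (b * xvar)"
    using congruence_mult[OF P(1) S V_D(1)[OF v(1)]] congruence_mult[OF P(1) S V_D(2)[OF v(1)]]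
    by (simp_all only: PS P(3,4) b)
  then obtain c where "S = M c" "b mod p = a * c\<^sup>2 mod p"
    using hankel_isometry[OF S _ _ b(3)] by blast
  thus thesis using that PS by blast
qed

text \<open>\<open>P * M c\<close> represents \<open>v\<close> with parameter \<open>b\<close>, as
  \<open>Q\<close> does \<open>w\<close>; matching these two bases gives the isometry.\<close>

lemma represents_isometry:
  assumes v: "v \<in> V" "represents v P a" and w: "w \<in> V" "represents w Q b"
    and c: "b mod p = a * c\<^sup>2 mod p"
  obtains g where "g \<in> carrier (SLpm n)" "pair_act g v = w" "g\<^sup>T * Q = P * M c"
proof -
  have P: "P \<in> carrier_mat n n" "P\<^sup>T * fst v * P = H a" "P\<^sup>T * snd v * P = H (a * xvar)"
    using v(2) by (auto simp: represents_def)
  have Q: "Q \<in> carrier_mat n n" "det Q \<noteq> 0" "Q\<^sup>T * fst w * Q = H b" "Q\<^sup>T * snd w * Q = H (b * xvar)"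
    using w(2) by (auto simp: represents_def)
  obtain K where K: "K \<in> carrier_mat n n" "Q * K = 1\<^sub>m n" "K * Q = 1\<^sub>m n"
    using inverse_matE[OF Q(1,2)] by metis
  define G where "G = P * M c * K"
  have PM: "P * M c \<in> carrier_mat n n" using P by simp
  have G: "G \<in> carrier_mat n n" unfolding G_def by (rule mult_carrier_mat[OF PM K(1)])
  have "b * xvar mod p = a * c\<^sup>2 * xvar mod p" by (metis c mod_mult_left_eq)
  also have "a * c\<^sup>2 * xvar = a * xvar * c\<^sup>2" by (simp only: mult_ac)
  finally have bx: "H (b * xvar) = H (a * xvar * c\<^sup>2)" by (rule hankel_mod)
  have "(P * M c)\<^sup>T * fst v * (P * M c) = H b"
    using congruence_mult[OF P(1) MC V_D(1)[OF v(1)], of c]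
    by (simp add: P(2) hankel_congruence hankel_mod[OF c])
  hence 1: "G\<^sup>T * fst v * G = fst w"
    using congruence_mult[OF PM K(1) V_D(1)[OF v(1)]] congruence_inverse[OF Q(1) K(1,2) V_D(1)[OF w(1)]]
    by (simp add: G_def Q(3))
  have "(P * M c)\<^sup>T * snd v * (P * M c) = H (b * xvar)"
    using congruence_mult[OF P(1) MC V_D(2)[OF v(1)], of c]
    by (simp only: P(3) hankel_congruence bx)
  hence 2: "G\<^sup>T * snd v * G = snd w"
    using congruence_mult[OF PM K(1) V_D(2)[OF v(1)]] congruence_inverse[OF Q(1) K(1,2) V_D(2)[OF w(1)]]
    by (simp add: G_def Q(4))
  \<comment> \<open>Both first forms have determinant (-1)^(n/2) f_0, so the isometry is forced to
    have determinant 1 or -1.\<close>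
  have "det (fst w) = (det G)\<^sup>2 * det (fst v)"
    using det_congruence[OF G V_D(1)[OF v(1)]] by (simp add: 1)
  hence "(det G)\<^sup>2 = 1" using V_D(5,6)[OF v(1)] V_D(5)[OF w(1)] by simp
  hence "G\<^sup>T \<in> carrier (SLpm n)" using G by (simp add: carrier_SLpm det_transpose[OF G] power2_eq_1_iff)
  moreover have "pair_act G\<^sup>T v = w" using 1 2 by (simp add: pair_act_def)
  moreover have "G * Q = (P * M c) * (K * Q)" using P(1) K(1) Q(1) by (simp add: G_def mat_assoc[where n = n])
  hence "(G\<^sup>T)\<^sup>T * Q = P * M c" using K PM by simp
  ultimately show thesis by (rule that)
qed

text \<open>\<open>g\<^sup>T * Q\<close> is a basis for \<open>v\<close> with parameter
  \<open>b\<close>, to be compared with \<open>P\<close>.\<close>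

lemma represents_pair_act:
  assumes g: "g \<in> carrier_mat n n" and v: "v \<in> V" "represents v P a" and w: "represents (pair_act g v) Q b"
  obtains c where "g\<^sup>T * Q = P * M c" "b mod p = a * c\<^sup>2 mod p"
proof -
  have Q: "Q \<in> carrier_mat n n" "det (M b) \<noteq> 0"
      "Q\<^sup>T * (g * fst v * g\<^sup>T) * Q = H b" "Q\<^sup>T * (g * snd v * g\<^sup>T) * Q = H (b * xvar)"
    using w by (auto simp: represents_def pair_act_def)
  have gt: "g\<^sup>T \<in> carrier_mat n n" using g by simp
  have "(g\<^sup>T * Q)\<^sup>T * fst v * (g\<^sup>T * Q) = H b" "(g\<^sup>T * Q)\<^sup>T * snd v * (g\<^sup>T * Q) = H (b * xvar)"
    using congruence_mult[OF gt Q(1) V_D(1)[OF v(1)]] congruence_mult[OF gt Q(1) V_D(2)[OF v(1)]]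
    by (simp_all add: Q)
  thus thesis using represents_change_basis[OF v _ _ _ Q(2), of "g\<^sup>T * Q"] gt Q(1) that
    by (metis mult_carrier_mat)
qed

section \<open>Orbits and square classes\<close>

definition pair_class :: "'a mat \<times> 'a mat \<Rightarrow> 'a poly set set" where
  "pair_class v = unit_class (SOME a. \<exists>P. represents v P a)"

text \<open>The choice in \<open>pair_class\<close> is immaterial, since two parameters of one pair
  differ by a square factor.\<close>

lemma pair_class_eq:
  assumes v: "v \<in> V" "represents v P a"
  shows "pair_class v = unit_class a"
proof -
  define b where "b = (SOME a. \<exists>P. represents v P a)"
  have "\<exists>Q. represents v Q b" unfolding b_def using v(2) by (intro someI_ex[of "\<lambda>a. \<exists>P. represents v P a"]) blast
  then obtain Q where Q: "represents v Q b" by blast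
  obtain c where "b mod p = a * c\<^sup>2 mod p"
    by (rule represents_change_basis[OF v, of Q b]) (use Q in \<open>auto simp: represents_def\<close>)
  hence "unit_class a = unit_class b"
    using unit_class_eq_iff[of a b] v(2) Q by (auto simp: represents_def)
  thus ?thesis by (simp add: pair_class_def b_def)
qed

text \<open>Both sides mean that the parameters differ by a square: a group element yields
  \<open>c\<close> through \<open>represents_pair_act\<close>, and
  \<open>represents_isometry\<close> goes back.\<close>

lemma orbit_eq_iff_pair_class_eq:
  assumes v: "v \<in> V" and w: "w \<in> V"
  shows "orbit (SLpm n) pair_act v = orbit (SLpm n) pair_act w \<longleftrightarrow> pair_class v = pair_class w"
proof -
  obtain P a where P: "represents v P a" using represents_exists[OF v] by blast
  obtain Q b where Q: "represents w Q b" using represents_exists[OF w] by blast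
  have "pair_class v = pair_class w \<longleftrightarrow> (\<exists>c. b mod p = a * c\<^sup>2 mod p)"
    using unit_class_eq_iff[of a b] P Q
    by (simp add: pair_class_eq[OF v P] pair_class_eq[OF w Q] represents_def)
  moreover have "(\<exists>g \<in> carrier (SLpm n). pair_act g v = w) \<longleftrightarrow> (\<exists>c. b mod p = a * c\<^sup>2 mod p)"
  proof
    assume "\<exists>g \<in> carrier (SLpm n). pair_act g v = w"
    then obtain g where "g \<in> carrier_mat n n" "pair_act g v = w" by (auto simp: carrier_SLpm)
    thus "\<exists>c. b mod p = a * c\<^sup>2 mod p" using represents_pair_act[of g v P a Q b] v P Q by blast
  next
    assume "\<exists>c. b mod p = a * c\<^sup>2 mod p"
    thus "\<exists>g \<in> carrier (SLpm n). pair_act g v = w"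
      using represents_isometry[OF v P w Q] by blast
  qed
  ultimately show ?thesis
    using orbit_SLpm_eq_iff[of v n w] v w by (auto simp: V_def)
qed

text \<open>Determinants give one inclusion; \<open>represents_surj\<close> realises every
  admissible class.\<close>

lemma pair_class_image: "pair_class ` V = norm_classes p (f 0)"
proof (intro equalityI subsetI)
  fix \<alpha> assume "\<alpha> \<in> pair_class ` V"
  then obtain v where v: "v \<in> V" "\<alpha> = pair_class v" by blast
  obtain P a where P: "represents v P a" using represents_exists[OF v(1)] by blast
  have "det (M a) = f 0 * (det P)\<^sup>2" "det P \<noteq> 0"
    using det_represents[OF v(1) P] P by (auto simp: represents_def)
  thus "\<alpha> \<in> norm_classes p (f 0)"
    using pair_class_eq[OF v(1) P] v(2) by (auto simp: norm_classes_eq[OF f0])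
next
  fix \<alpha> assume "\<alpha> \<in> norm_classes p (f 0)"
  then obtain a d where a: "\<alpha> = unit_class a" "d \<noteq> 0" "det (M a) = f 0 * d\<^sup>2"
    by (auto simp: norm_classes_eq[OF f0])
  then obtain v P where "v \<in> V" "represents v P a" using represents_surj by blast
  thus "\<alpha> \<in> pair_class ` V" using pair_class_eq a(1) by blast
qed

lemma orbits_bij: "\<exists>\<Phi>. bij_betw \<Phi> (orbits (SLpm n) V pair_act) (norm_classes p (f 0))"
proof -
  have "orbits (SLpm n) V pair_act = orbit (SLpm n) pair_act ` V" by (auto simp: orbits_def)
  thus ?thesis
    using bij_betw_quotient[of V "orbit (SLpm n) pair_act" pair_class] orbit_eq_iff_pair_class_eq
    by (simp add: pair_class_image)
qed

section \<open>Stabilizers and two-torsion units\<close>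

lemma two_torsion_units_carrier:
  "carrier (two_torsion_units (quot_alg p)) = {quot_class p c | c. c\<^sup>2 mod p = 1 mod p}"
proof -
  \<comment> \<open>A residue with square 1 is its own inverse.\<close>
  have nz: "det (M c) \<noteq> 0" if "c\<^sup>2 mod p = 1 mod p" for c
    using that det_mult_mat_nz_iff[of c] by (auto simp: power2_eq_square)
  have car: "carrier (two_torsion_units (quot_alg p)) =
      {u \<in> Units (quot_alg p). u [^]\<^bsub>quot_alg p\<^esub> (2::nat) = \<one>\<^bsub>quot_alg p\<^esub>}"
    by (simp add: two_torsion_units_def)
  show ?thesis
  proof (intro equalityI subsetI)
    fix u assume "u \<in> carrier (two_torsion_units (quot_alg p))"
    then obtain c where "u = quot_class p c" "quot_class p (c\<^sup>2) = quot_class p 1"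
      unfolding car Units_quot_alg using quot_class_square[of p] one_quot_alg[of p] by auto
    thus "u \<in> {quot_class p c | c. c\<^sup>2 mod p = 1 mod p}" unfolding quot_class_eq_iff by blast
  next
    fix u assume "u \<in> {quot_class p c | c. c\<^sup>2 mod p = 1 mod p}"
    then obtain c where c: "u = quot_class p c" "c\<^sup>2 mod p = 1 mod p" by blast
    moreover have "quot_class p c [^]\<^bsub>quot_alg p\<^esub> (2::nat) = \<one>\<^bsub>quot_alg p\<^esub>"
      using c(2) by (simp only: quot_class_square one_quot_alg quot_class_eq_iff)
    ultimately show "u \<in> carrier (two_torsion_units (quot_alg p))"
      unfolding car Units_quot_alg using nz by blast
  qed
qed

text \<open>In a basis \<open>P\<close> for \<open>v\<close>, the transpose of a stabilizing element
  is multiplication by some \<open>c\<close> with a = a c^2, that is c^2 = 1. Sending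
  \<open>g\<close> to \<open>c\<close> is the isomorphism.\<close>

lemma stabilizer_iso:
  assumes v: "v \<in> V"
  shows "stabilizer_group n v \<cong> two_torsion_units (quot_alg p)"
proof -
  let ?G = "stabilizer_group n v"
  obtain P a where rep: "represents v P a" using represents_exists[OF v] by blast
  have P: "P \<in> carrier_mat n n" "det P \<noteq> 0" "det (M a) \<noteq> 0" using rep by (auto simp: represents_def)
  define h where "h g = quot_class p (SOME c. g\<^sup>T * P = P * M c)" for g
  have h: "h g = quot_class p c" if "g\<^sup>T * P = P * M c" for g c
  proof -
    have "g\<^sup>T * P = P * M (SOME c. g\<^sup>T * P = P * M c)" using that by (rule someI)
    hence "M (SOME c. g\<^sup>T * P = P * M c) = M c"
      using that by (intro mat_left_cancel[OF P(1,2) MC MC]) simp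
    thus ?thesis by (simp add: h_def quot_class_eq_iff mult_mat_eq_iff)
  qed
  have G: "carrier ?G = {g \<in> carrier (SLpm n). pair_act g v = v}"
    by (simp add: stabilizer_group_def stabilizer_def)
  obtain b where b: "a * b mod p = 1 mod p" using P(3) det_mult_mat_nz_iff by blast
  \<comment> \<open>The unit \<open>a\<close> is cancelled by means of its inverse
    \<open>b\<close>.\<close>
  have sq: "c\<^sup>2 mod p = 1 mod p" if "a mod p = a * c\<^sup>2 mod p" for c
  proof -
    have "c\<^sup>2 mod p = a * b * c\<^sup>2 mod p" using b by (metis mod_mult_left_eq mult_1)
    also have "\<dots> = a * c\<^sup>2 * b mod p" by (simp add: mult_ac)
    also have "\<dots> = a * b mod p" using that by (metis mod_mult_left_eq)
    finally show ?thesis using b by simp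
  qed
  have stabD: "\<exists>c. g\<^sup>T * P = P * M c \<and> c\<^sup>2 mod p = 1 mod p" if "g \<in> carrier ?G" for g
    using represents_pair_act[of g v P a P a] that rep v sq by (auto simp: G carrier_SLpm)
  have stabI: "\<exists>g \<in> carrier ?G. g\<^sup>T * P = P * M c" if "c\<^sup>2 mod p = 1 mod p" for c
  proof -
    have "a mod p = a * c\<^sup>2 mod p" using that by (metis mod_mult_right_eq mult.right_neutral)
    thus ?thesis using represents_isometry[OF v rep v rep, of c] by (auto simp: G)
  qed
  have gc: "g \<in> carrier_mat n n" if "g \<in> carrier ?G" for g
    using that by (simp add: G carrier_SLpm)
  have "h \<in> hom ?G (two_torsion_units (quot_alg p))"
  proof (rule homI)
    fix g assume "g \<in> carrier ?G"
    thus "h g \<in> carrier (two_torsion_units (quot_alg p))"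
      using stabD[of g] h by (auto simp: two_torsion_units_carrier)
  next
    fix g1 g2 assume g: "g1 \<in> carrier ?G" "g2 \<in> carrier ?G"
    obtain c1 c2 where c: "g1\<^sup>T * P = P * M c1" "g2\<^sup>T * P = P * M c2" using stabD g by meson
    \<comment> \<open>Transposition reverses products; commutativity of k[x]/(p) turns the resulting
      antihomomorphism into a homomorphism.\<close>
    have "(g1 * g2)\<^sup>T * P = g2\<^sup>T * (g1\<^sup>T * P)"
      using gc[OF g(1)] gc[OF g(2)] P(1) by (simp add: transpose_mult[of _ n n _ n] mat_assoc[where n = n])
    also have "\<dots> = g2\<^sup>T * P * M c1"
      unfolding c(1) using gc[OF g(2)] P(1) by (simp add: mat_assoc[where n = n])
    also have "\<dots> = P * M (c2 * c1)"
      unfolding c(2) mult_mat_mult using P(1) by (simp add: mat_assoc[where n = n])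
    finally have "h (g1 * g2) = quot_class p (c2 * c1)" by (rule h)
    thus "h (g1 \<otimes>\<^bsub>?G\<^esub> g2) = h g1 \<otimes>\<^bsub>two_torsion_units (quot_alg p)\<^esub> h g2"
      by (simp add: stabilizer_group_def SLpm_def two_torsion_units_def units_of_mult
          h[OF c(1)] h[OF c(2)] mult_quot_class mult.commute)
  qed
  moreover have "inj_on h (carrier ?G)"
  proof (rule inj_onI)
    fix g1 g2 assume g: "g1 \<in> carrier ?G" "g2 \<in> carrier ?G" and eq: "h g1 = h g2"
    obtain c1 c2 where c: "g1\<^sup>T * P = P * M c1" "g2\<^sup>T * P = P * M c2" using stabD g by meson
    have "M c1 = M c2" using eq by (simp add: h[OF c(1)] h[OF c(2)] quot_class_eq_iff mult_mat_eq_iff)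
    hence "g1\<^sup>T * P = g2\<^sup>T * P" using c by simp
    hence "(g1\<^sup>T * P)\<^sup>T = (g2\<^sup>T * P)\<^sup>T" by (rule arg_cong)
    moreover have "(g\<^sup>T * P)\<^sup>T = P\<^sup>T * g" if "g \<in> carrier ?G" for g
      using gc[OF that] P(1) by (simp add: transpose_mult[of _ n n _ n])
    ultimately have "P\<^sup>T * g1 = P\<^sup>T * g2" using g by simp
    thus "g1 = g2"
      using mat_left_cancel[of "P\<^sup>T" n g1 g2] gc g P by (simp add: det_transpose[OF P(1)])
  qed
  moreover have "h ` carrier ?G = carrier (two_torsion_units (quot_alg p))"
  proof (intro equalityI subsetI)
    fix u assume "u \<in> h ` carrier ?G"
    thus "u \<in> carrier (two_torsion_units (quot_alg p))"
      using stabD h by (force simp: two_torsion_units_carrier)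
  next
    fix u assume "u \<in> carrier (two_torsion_units (quot_alg p))"
    then obtain c where "u = quot_class p c" "c\<^sup>2 mod p = 1 mod p" by (auto simp: two_torsion_units_carrier)
    thus "u \<in> h ` carrier ?G" using stabI[of c] h by force
  qed
  ultimately have "h \<in> iso ?G (two_torsion_units (quot_alg p))"
    by (simp add: iso_def bij_betw_def)
  thus ?thesis by (rule is_isoI)
qed

end

theorem theorem7:
  fixes n :: nat and f :: "nat \<Rightarrow> 'a::field"
  assumes "n \<ge> 2" and "even n"
    and "f 0 \<noteq> 0"
    and "separable_form n (binary_form n f)"
  defines "V\<^sub>f \<equiv> {v \<in> sym_pairs n. invariant_form n v = binary_form n f}"
    and "p \<equiv> dehomogenize (binary_form n f)"
  shows "(\<exists>\<Phi>. bij_betw \<Phi> (orbits (SLpm n) V\<^sub>f pair_act) (norm_classes p (f 0))) \<and>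
         (\<forall>v \<in> V\<^sub>f. stabilizer_group n v \<cong> two_torsion_units (quot_alg p))"
proof -
  interpret separable_binary_form n f using assms(1-4) by unfold_locales
  have "V\<^sub>f = V" unfolding V\<^sub>f_def V_def ..
  thus ?thesis using orbits_bij stabilizer_iso by (simp add: p_def)
qed

end
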